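(* The set $g(I_n, D_n)$ of all essential pairs associated with the icosahedral numbers $I_n$ and the dodecahedral numbers $D_n$ is $$g(I_n,D_n)=\{(5,6),(4,7),(3,8),(2,9),(1,11),(0,22),(6,5),(7,4),(8,3),(9,2),(10,1),(15,0)\}.$$
   Context: For $n\in\mathbb{N}\cup\{0\}$, the $n$-th icosahedral number is $I_n=\frac{n(5n^2-5n+2)}{2}$ and the $n$-th dodecahedral number is $D_n=\frac{n(3n-1)(3n-2)}{2}$ (so $I_0=D_0=0$, $I_1=D_1=1$, $I_2=12$, $D_2=20$). A pair $(u,v)\in\mathbb{Z}_{\geq 0}\times\mathbb{Z}_{\geq 0}$ is called an admissible pair (associated with $I_n$ and $D_n$) if every positive integer $m$ can be expressed as $$m=\sum_{i=1}^{a} I_{n_i}+\sum_{j=1}^{b} D_{\ell_j}$$ for some integers $0\le a\leq u$, $0\le b\leq v$ and some $n_i,\ell_j\in\mathbb{N}\cup\{0\}$. (The first coordinate bounds the number of icosahedral terms, the second the number of dodecahedral terms.) The set $g(I_n,D_n)$ consists of all minimal admissible pairs, i.e. all admissible pairs $(u,v)$ such that there is no admissible pair $(u',v')$ with $u'\leq u$, $v'\leq v$ and at least one of these inequalities strict. The elements of $g(I_n,D_n)$ are called essential pairs. *)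

theory Defs
  imports Complex_Main
begin

definition icosahedral :: "nat \<Rightarrow> int" where
  "icosahedral n = int n * (5 * (int n)^2 - 5 * int n + 2) div 2"

definition dodecahedral :: "nat \<Rightarrow> int" where
  "dodecahedral n = int n * (3 * int n - 1) * (3 * int n - 2) div 2"

lemma two_times_icosahedral:
  "2 * icosahedral n = int n * (5 * (int n)^2 - 5 * int n + 2)"
  unfolding icosahedral_def by (rule dvd_mult_div_cancel) (cases "even n"; simp)

lemma two_times_dodecahedral:
  "2 * dodecahedral n = int n * (3 * int n - 1) * (3 * int n - 2)"
  unfolding dodecahedral_def by (rule dvd_mult_div_cancel) (cases "even n"; simp)

definition admissible_pair :: "nat \<Rightarrow> nat \<Rightarrow> bool" where
  "admissible_pair u v \<longleftrightarrow>
     (\<forall>m::int. m > 0 \<longrightarrow>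
       (\<exists>a b. a \<le> u \<and> b \<le> v \<and>
         (\<exists>(n :: nat \<Rightarrow> nat) (l :: nat \<Rightarrow> nat).
            m = (\<Sum>i=1..a. icosahedral (n i)) + (\<Sum>j=1..b. dodecahedral (l j)))))"

definition essential_pairs :: "(nat \<times> nat) set" where
  "essential_pairs =
     {(u, v). admissible_pair u v \<and>
        \<not> (\<exists>u' v'. admissible_pair u' v' \<and> u' \<le> u \<and> v' \<le> v \<and> (u' < u \<or> v' < v))}"

end

theory Submission
  imports Defs "HOL-Number_Theory.Cong"
begin

text \<open>
Put \<open>P c n = (c n^3 - c n^2 + 2 n) / 2\<close>, so that \<open>I n = P 5 n\<close> and \<open>D n = P 9 n\<close>. Symmetric pairs satisfy
\<open>P c (a + x) + P c (a - x) = 2 P c a + c (3 a - 1) x^2\<close>. By Lagrange's theorem, eight icosahedral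
(dodecahedral) numbers centred at \<open>a\<close> therefore produce a constant plus any multiple \<open>5 A m\<close> (\<open>9 A m\<close>) with
\<open>A = 3 a - 1\<close> and \<open>0 \<le> m \<le> a^2\<close>. Four of each kind produce \<open>5 A m\<close> for \<open>m \<equiv> 2\<close> modulo 3: a sum of
four squares congruent to 2 modulo 3 has exactly two terms divisible by 3, and
\<open>45 (z^2 + w^2) = 9 ((2 z + w)^2 + (z - 2 w)^2)\<close>. Taking \<open>A = 2^(2 k + 1)\<close>, three further summands of
prescribed kinds bring a given large number into the right residue class modulo \<open>15 A\<close> or \<open>9 A\<close> and
into the window of length about \<open>15 a^3\<close>. This settles all numbers from about \<open>10^21\<close> on.

Below that bound, an interval of numbers represented by few summands is computed, and every
further summand extends an interval of length \<open>L\<close> to one of length of order \<open>L^(3/2)\<close>.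

Minimality follows from the numbers 11, 31, 79 and 95, which involve only the values 1, 12, 48
and 1, 20.
\<close>

section \<open>Sums of four squares\<close>

definition sum4 :: "int \<Rightarrow> bool" where
  "sum4 n \<longleftrightarrow> (\<exists>a b c d. n = a\<^sup>2 + b\<^sup>2 + c\<^sup>2 + d\<^sup>2)"

text \<open>The signs are those of multiplication by a conjugate quaternion: if (a, b, c, d) and (x,
  y, z, w) agree modulo m, the last three bases on the right vanish modulo m, which the descent
  exploits.\<close>

lemma euler_four_square:
  fixes a b c d x y z w :: int
  shows "(a\<^sup>2 + b\<^sup>2 + c\<^sup>2 + d\<^sup>2) * (x\<^sup>2 + y\<^sup>2 + z\<^sup>2 + w\<^sup>2) =
    (a*x + b*y + c*z + d*w)\<^sup>2 + (a*y - b*x + c*w - d*z)\<^sup>2 +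
    (a*z - c*x + d*y - b*w)\<^sup>2 + (a*w - d*x + b*z - c*y)\<^sup>2"
  by algebra

lemma sum4_mult: "sum4 m \<Longrightarrow> sum4 n \<Longrightarrow> sum4 (m * n)"
  unfolding sum4_def using euler_four_square by metis

lemma least_abs_residue:
  fixes x m :: int
  assumes "m > 0"
  obtains y where "m dvd x - y" "2 * \<bar>y\<bar> \<le> m"
proof
  define y where "y = (x + m div 2) mod m - m div 2"
  show "m dvd x - y"
  proof -
    have "x - y = (x + m div 2) - (x + m div 2) mod m" by (simp add: y_def)
    also have "m dvd \<dots>" by (rule dvd_minus_mod)
    finally show ?thesis .
  qed
  have "0 \<le> (x + m div 2) mod m" "(x + m div 2) mod m < m" using assms by simp_all
  moreover have "m = 2 * (m div 2) + m mod 2" "0 \<le> m mod 2" "m mod 2 < 2" by simp_all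
  ultimately show "2 * \<bar>y\<bar> \<le> m" unfolding y_def by (smt (verit))
qed

text \<open>Pigeonhole: on 0, ..., (p - 1)/2 the maps x^2 and -1 - y^2 are injective modulo p, so
  together they take p + 1 values among p residues and must meet. The size bounds later make the
  quotient smaller than p.\<close>

lemma prime_dvd_sum_two_squares_plus_one:
  fixes p :: int
  assumes p: "prime p" and odd: "odd p"
  obtains x y where "p dvd x\<^sup>2 + y\<^sup>2 + 1" "2 * \<bar>x\<bar> < p" "2 * \<bar>y\<bar> < p"
proof -
  define S where "S = {0..(p - 1) div 2}"
  define f where "f x = x\<^sup>2 mod p" for x :: int
  define f' where "f' x = (- 1 - x\<^sup>2) mod p" for x :: int
  have p1: "p > 1" using p prime_gt_1_int by blast
  have key: "x = y" if "x \<in> S" "y \<in> S" "p dvd x\<^sup>2 - y\<^sup>2" for x y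
  proof (rule ccontr)
    assume "x \<noteq> y"
    have "p dvd (x - y) * (x + y)" using that(3) by (simp add: power2_eq_square algebra_simps)
    then have "p dvd x - y \<or> p dvd x + y" using p prime_dvd_mult_iff by blast
    moreover have "\<bar>x - y\<bar> < p" "0 \<le> x + y" "x + y < p"
      using that(1,2) odd p1 unfolding S_def by (auto elim!: oddE)
    moreover have "x + y \<noteq> 0" "x - y \<noteq> 0" using that(1,2) \<open>x \<noteq> y\<close> unfolding S_def by auto
    ultimately show False
      by (metis abs_dvd_iff abs_of_nonneg dvd_imp_le_int not_le p1 abs_of_pos zero_less_one order.strict_trans)
  qed
  have "inj_on f S"
    by (rule inj_onI) (metis f_def key mod_eq_dvd_iff)
  moreover have "inj_on f' S"
  proof (rule inj_onI)
    fix x y assume xy: "x \<in> S" "y \<in> S" "f' x = f' y"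
    then have "p dvd (- 1 - x\<^sup>2) - (- 1 - y\<^sup>2)" unfolding f'_def by (simp only: mod_eq_dvd_iff)
    then have "p dvd y\<^sup>2 - x\<^sup>2" by simp
    then show "x = y" using key xy by metis
  qed
  moreover have "card S = nat ((p + 1) div 2)" unfolding S_def using odd p1 by (auto elim!: oddE)
  ultimately have c: "card (f ` S) + card (f' ` S) = nat (p + 1)"
    using odd p1 by (auto simp: card_image elim!: oddE)
  have sub: "f ` S \<union> f' ` S \<subseteq> {0..<p}" using p1 by (auto simp: f_def f'_def)
  then have "card (f ` S \<union> f' ` S) \<le> nat p" using card_mono[OF _ sub] by simp
  moreover have "finite (f ` S)" "finite (f' ` S)" unfolding S_def by auto
  ultimately have "f ` S \<inter> f' ` S \<noteq> {}"
    using c p1 card_Un_disjoint[of "f ` S" "f' ` S"] by auto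
  then obtain x y where xy: "x \<in> S" "y \<in> S" "f x = f' y" by auto
  then have "p dvd x\<^sup>2 - (- 1 - y\<^sup>2)" unfolding f_def f'_def by (simp only: mod_eq_dvd_iff)
  then have "p dvd x\<^sup>2 + y\<^sup>2 + 1" by (simp add: algebra_simps)
  moreover have "2 * \<bar>x\<bar> < p" "2 * \<bar>y\<bar> < p" using xy p1 odd unfolding S_def by (auto elim!: oddE)
  ultimately show thesis using that by blast
qed

text \<open>Lagrange's descent: replace a, b, c, d by absolutely least residues x, y, z, w modulo m,
  with square sum m * r and r <= m. In Euler's identity for the product of both sums all four bases
  are divisible by m, and cancelling m^2 leaves r * p. The extreme cases r = 0 and r = m would give
  m^2 dvd m * p, hence m dvd p.\<close>

lemma sum4_descent:
  fixes p m :: int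
  assumes p: "prime p" and m: "1 < m" "m < p" and s: "sum4 (m * p)"
  obtains r where "0 < r" "r < m" "sum4 (r * p)"
proof -
  obtain a b c d where abcd: "m * p = a\<^sup>2 + b\<^sup>2 + c\<^sup>2 + d\<^sup>2" using s unfolding sum4_def by blast
  have m0: "m > 0" using m by simp
  obtain x where x: "m dvd a - x" "2 * \<bar>x\<bar> \<le> m" using least_abs_residue[OF m0] by blast
  obtain y where y: "m dvd b - y" "2 * \<bar>y\<bar> \<le> m" using least_abs_residue[OF m0] by blast
  obtain z where z: "m dvd c - z" "2 * \<bar>z\<bar> \<le> m" using least_abs_residue[OF m0] by blast
  obtain w where w: "m dvd d - w" "2 * \<bar>w\<bar> \<le> m" using least_abs_residue[OF m0] by blast
  obtain a' b' c' d' where e: "a = x + m * a'" "b = y + m * b'" "c = z + m * c'" "d = w + m * d'"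
    using x(1) y(1) z(1) w(1) by (metis add_diff_cancel_left' diff_add_cancel dvdE add.commute)
  have sq: "4 * v\<^sup>2 \<le> m\<^sup>2" if "2 * \<bar>v\<bar> \<le> m" for v
    using power_mono[OF that, of 2] by (simp add: power_mult_distrib)
  have not_dvd: "\<not> m * m dvd m * p"
  proof
    assume "m * m dvd m * p"
    then have "m dvd p" using m0 by simp
    then show False using p m by (metis prime_int_iff m0 less_imp_le not_less_iff_gr_or_eq)
  qed
  define n where "n = x\<^sup>2 + y\<^sup>2 + z\<^sup>2 + w\<^sup>2"
  have nm: "m * p = n + m * (2 * (x*a' + y*b' + z*c' + w*d') + m * (a'\<^sup>2 + b'\<^sup>2 + c'\<^sup>2 + d'\<^sup>2))"
    unfolding abcd e n_def by algebra
  then have "m dvd n" by (metis dvd_add_left_iff dvd_triv_left)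
  then obtain r where r: "n = m * r" by blast
  have le: "4 * n \<le> 4 * m\<^sup>2" using sq[OF x(2)] sq[OF y(2)] sq[OF z(2)] sq[OF w(2)] unfolding n_def by simp
  have n0: "n \<ge> 0" unfolding n_def by simp
  have "r \<noteq> 0"
  proof
    assume "r = 0"
    then have "x = 0 \<and> y = 0 \<and> z = 0 \<and> w = 0"
      using r unfolding n_def by (simp add: add_nonneg_eq_0_iff)
    then have "m * p = m * m * (a'\<^sup>2 + b'\<^sup>2 + c'\<^sup>2 + d'\<^sup>2)" using nm r \<open>r = 0\<close> by simp
    then show False using not_dvd by (metis dvd_triv_left)
  qed
  moreover have "r \<ge> 0" using r n0 m0 by (simp add: zero_le_mult_iff)
  \<comment> \<open>Equality forces every residue to be m/2 in absolute value. The doubled residues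
    are then multiples of m, so the cross terms contribute a multiple of m^2 as well.\<close>
  moreover have "r \<noteq> m"
  proof
    assume "r = m"
    then have eq: "4 * n = 4 * m\<^sup>2" using r by (simp add: power2_eq_square)
    have "4 * x\<^sup>2 = m\<^sup>2" "4 * y\<^sup>2 = m\<^sup>2" "4 * z\<^sup>2 = m\<^sup>2" "4 * w\<^sup>2 = m\<^sup>2"
      using eq sq[OF x(2)] sq[OF y(2)] sq[OF z(2)] sq[OF w(2)] unfolding n_def by (smt (verit))+
    then have "(2*x)\<^sup>2 = m\<^sup>2" "(2*y)\<^sup>2 = m\<^sup>2" "(2*z)\<^sup>2 = m\<^sup>2" "(2*w)\<^sup>2 = m\<^sup>2"
      by (simp_all add: power_mult_distrib)
    then have "m dvd 2*x" "m dvd 2*y" "m dvd 2*z" "m dvd 2*w" by (metis dvd_refl pow_divides_pow_iff pos2)+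
    then obtain x' y' z' w' where h: "2*x = m*x'" "2*y = m*y'" "2*z = m*z'" "2*w = m*w'"
      by (auto elim!: dvdE)
    have "2 * (x*a' + y*b' + z*c' + w*d') = m * (x'*a' + y'*b' + z'*c' + w'*d')"
      using h by (simp add: algebra_simps)
    then have "m * p = m * m * (1 + (x'*a' + y'*b' + z'*c' + w'*d') + (a'\<^sup>2 + b'\<^sup>2 + c'\<^sup>2 + d'\<^sup>2))"
      using nm r \<open>r = m\<close> by (simp add: algebra_simps)
    then show False using not_dvd by (metis dvd_triv_left)
  qed
  moreover have "r \<le> m" using le r m0 by (simp add: power2_eq_square)
  moreover have "sum4 (r * p)"
  proof -
    define A where "A = r + (a'*x + b'*y + c'*z + d'*w)"
    define B where "B = a'*y - b'*x + c'*w - d'*z"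
    define C where "C = a'*z - c'*x + d'*y - b'*w"
    define D where "D = a'*w - d'*x + b'*z - c'*y"
    have "a*x + b*y + c*z + d*w = n + m * (a'*x + b'*y + c'*z + d'*w)"
      unfolding e n_def by algebra
    then have 1: "a*x + b*y + c*z + d*w = m * A" unfolding r A_def by (simp add: algebra_simps)
    have 2: "a*y - b*x + c*w - d*z = m * B" "a*z - c*x + d*y - b*w = m * C" "a*w - d*x + b*z - c*y = m * D"
      unfolding e B_def C_def D_def by algebra+
    have "(m * p) * n = (m * A)\<^sup>2 + (m * B)\<^sup>2 + (m * C)\<^sup>2 + (m * D)\<^sup>2"
      unfolding abcd n_def euler_four_square 1 2 ..
    then have "m\<^sup>2 * (r * p) = m\<^sup>2 * (A\<^sup>2 + B\<^sup>2 + C\<^sup>2 + D\<^sup>2)"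
      unfolding r by (simp add: algebra_simps power2_eq_square)
    then have "r * p = A\<^sup>2 + B\<^sup>2 + C\<^sup>2 + D\<^sup>2" using m0 by simp
    then show ?thesis unfolding sum4_def by blast
  qed
  ultimately show thesis using that[of r] by linarith
qed

lemma sum4_prime:
  fixes p :: int
  assumes p: "prime p"
  shows "sum4 p"
proof (cases "odd p")
  case False
  then have "p = 2" using p by (metis prime_int_iff even_numeral one_neq_zero dvd_refl zero_le_numeral one_eq_numeral_iff verit_eq_simplify(10))
  moreover have "(2::int) = 1\<^sup>2 + 1\<^sup>2 + 0\<^sup>2 + 0\<^sup>2" by simp
  ultimately show ?thesis unfolding sum4_def by blast
next
  case True
  obtain x y where xy: "p dvd x\<^sup>2 + y\<^sup>2 + 1" "2 * \<bar>x\<bar> < p" "2 * \<bar>y\<bar> < p"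
    using prime_dvd_sum_two_squares_plus_one[OF p True] by blast
  then obtain m where m: "x\<^sup>2 + y\<^sup>2 + 1 = p * m" by blast
  have p1: "p > 1" using p prime_gt_1_int by blast
  have m0: "m > 0"
  proof -
    have "p * m > 0" unfolding m[symmetric] by (simp add: add_nonneg_pos)
    then show ?thesis using p1 by (simp add: zero_less_mult_iff)
  qed
  have "4 * x\<^sup>2 \<le> (p - 1)\<^sup>2" "4 * y\<^sup>2 \<le> (p - 1)\<^sup>2"
    using power_mono[of "2 * \<bar>x\<bar>" "p - 1" 2] power_mono[of "2 * \<bar>y\<bar>" "p - 1" 2] xy
    by (simp_all add: power_mult_distrib)
  then have "4 * (p * m) \<le> 2 * (p - 1)\<^sup>2 + 4" unfolding m[symmetric] by simp
  also have "\<dots> < 4 * (p * p)"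
  proof -
    have "p * p > 1 * 1" using p1 by (intro mult_strict_mono) auto
    then show ?thesis using p1 by (simp add: power2_eq_square algebra_simps)
  qed
  finally have mp: "m < p" using p1 by simp
  have "sum4 (m * p)" unfolding sum4_def
    by (rule exI[of _ x], rule exI[of _ y], rule exI[of _ 1], rule exI[of _ 0]) (simp add: m mult.commute)
  with m0 mp show ?thesis
  proof (induction "nat m" arbitrary: m rule: less_induct)
    case less
    show ?case
    proof (cases "m = 1")
      case True
      then show ?thesis using less by simp
    next
      case False
      then obtain r where "0 < r" "r < m" "sum4 (r * p)"
        using sum4_descent[OF p, of m] less.prems by auto
      then show ?thesis using less.hyps[of r] less.prems by auto
    qed
  qed
qed

theorem four_squares:
  fixes n :: int
  assumes "n \<ge> 0"
  shows "sum4 n"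
proof -
  have "sum4 (int k)" for k
  proof (induction k rule: prime_divisors_induct)
    case zero
    have "int 0 = 0\<^sup>2 + 0\<^sup>2 + 0\<^sup>2 + 0\<^sup>2" by simp
    then show ?case unfolding sum4_def by blast
  next
    case (unit k)
    then have "int k = 1\<^sup>2 + 0\<^sup>2 + 0\<^sup>2 + 0\<^sup>2" by simp
    then show ?case unfolding sum4_def by blast
  next
    case (factor q k)
    then show ?case using sum4_mult[OF sum4_prime[of "int q"]] by simp
  qed
  from this[of "nat n"] show ?thesis using assms by simp
qed

lemma four_squares_two_multiples_of_three:
  fixes m :: int
  assumes "m \<ge> 0" "m mod 3 = 2"
  obtains x y z w where "m = x\<^sup>2 + y\<^sup>2 + 9 * (z\<^sup>2 + w\<^sup>2)"
proof -
  have sq: "v\<^sup>2 mod 3 = (if 3 dvd v then 0 else 1)" for v :: int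
  proof -
    have "v mod 3 = 0 \<or> v mod 3 = 1 \<or> v mod 3 = 2" by auto
    then have "(v mod 3)\<^sup>2 mod 3 = (if v mod 3 = 0 then 0 else 1)"
      by (elim disjE) simp_all
    then show ?thesis by (simp only: power_mod dvd_eq_mod_eq_0)
  qed
  have *: "\<exists>x y z w. m = x\<^sup>2 + y\<^sup>2 + 9 * (z\<^sup>2 + w\<^sup>2)" if "m = x\<^sup>2 + y\<^sup>2 + z\<^sup>2 + w\<^sup>2" "3 dvd z" "3 dvd w" for x y z w
  proof -
    obtain z' w' where "z = 3 * z'" "w = 3 * w'" using \<open>3 dvd z\<close> \<open>3 dvd w\<close> unfolding dvd_def by blast
    then have "m = x\<^sup>2 + y\<^sup>2 + 9 * (z'\<^sup>2 + w'\<^sup>2)" using \<open>m = _\<close> by (simp add: power_mult_distrib)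
    then show ?thesis by blast
  qed
  obtain a b c d where abcd: "m = a\<^sup>2 + b\<^sup>2 + c\<^sup>2 + d\<^sup>2"
    using four_squares[OF assms(1)] unfolding sum4_def by blast
  have sum_mod: "(A mod 3 + B mod 3 + C mod 3 + D mod 3) mod 3 = (A + B + C + D) mod 3" for A B C D :: int
  proof -
    have "[A mod 3 + B mod 3 + C mod 3 + D mod 3 = A + B + C + D] (mod 3)"
      by (intro cong_add) (simp_all add: cong_def)
    then show ?thesis by (simp add: cong_def)
  qed
  have "(a\<^sup>2 mod 3 + b\<^sup>2 mod 3 + c\<^sup>2 mod 3 + d\<^sup>2 mod 3) mod 3 = 2"
    using assms(2) unfolding abcd sum_mod .
  then have "3 dvd c \<and> 3 dvd d \<or> 3 dvd b \<and> 3 dvd d \<or> 3 dvd b \<and> 3 dvd c \<or>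
      3 dvd a \<and> 3 dvd d \<or> 3 dvd a \<and> 3 dvd c \<or> 3 dvd a \<and> 3 dvd b"
    unfolding sq by (auto split: if_splits)
  then have "\<exists>x y z w. m = x\<^sup>2 + y\<^sup>2 + 9 * (z\<^sup>2 + w\<^sup>2)"
  proof (elim disjE conjE)
    show ?thesis if "3 dvd c" "3 dvd d" by (rule *[of a b c d]) (use that abcd in linarith)+
    show ?thesis if "3 dvd b" "3 dvd d" by (rule *[of a c b d]) (use that abcd in linarith)+
    show ?thesis if "3 dvd b" "3 dvd c" by (rule *[of a d b c]) (use that abcd in linarith)+
    show ?thesis if "3 dvd a" "3 dvd d" by (rule *[of b c a d]) (use that abcd in linarith)+
    show ?thesis if "3 dvd a" "3 dvd c" by (rule *[of b d a c]) (use that abcd in linarith)+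
    show ?thesis if "3 dvd a" "3 dvd b" by (rule *[of c d a b]) (use that abcd in linarith)+
  qed
  then show thesis using that by blast
qed

section \<open>Representations by symmetric pairs\<close>

text \<open>This is the P of the introduction. Integer arguments allow congruences and differences
  such as a - x without truncated subtraction.\<close>

definition fig :: "int \<Rightarrow> int \<Rightarrow> int" where
  "fig c x = (c * x^3 - c * x\<^sup>2 + 2 * x) div 2"

lemma two_fig: "2 * fig c x = c * x^3 - c * x\<^sup>2 + 2 * x"
proof -
  have "even (c * x^3 - c * x\<^sup>2 + 2 * x)" by simp
  then show ?thesis unfolding fig_def by simp
qed

lemma fig_0 [simp]: "fig c 0 = 0"
  by (simp add: fig_def)

lemma icosahedral_eq_fig: "icosahedral n = fig 5 (int n)"
  using two_times_icosahedral[of n] two_fig[of 5 "int n"]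
  by (simp add: algebra_simps power2_eq_square power3_eq_cube)

lemma dodecahedral_eq_fig: "dodecahedral n = fig 9 (int n)"
  using two_times_dodecahedral[of n] two_fig[of 9 "int n"]
  by (simp add: algebra_simps power2_eq_square power3_eq_cube)

text \<open>The counts are exact, but \<open>fig c 0\<close> = 0 is a legal summand, so exact counts
  and upper bounds amount to the same thing.\<close>

inductive rep :: "nat \<Rightarrow> nat \<Rightarrow> int \<Rightarrow> bool" where
  rep_0: "rep 0 0 0"
| rep_Suc_left: "rep u v m \<Longrightarrow> 0 \<le> x \<Longrightarrow> rep (Suc u) v (m + fig 5 x)"
| rep_Suc_right: "rep u v m \<Longrightarrow> 0 \<le> x \<Longrightarrow> rep u (Suc v) (m + fig 9 x)"

lemma rep_add: "rep u v m \<Longrightarrow> rep u' v' m' \<Longrightarrow> rep (u + u') (v + v') (m + m')"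
proof (induction rule: rep.induct)
  case (rep_Suc_left u v m x)
  then show ?case using rep.rep_Suc_left[of "u + u'" "v + v'" "m + m'" x] by (simp add: add_ac)
next
  case (rep_Suc_right u v m x)
  then show ?case using rep.rep_Suc_right[of "u + u'" "v + v'" "m + m'" x] by (simp add: add_ac)
qed simp

lemma rep_zero: "rep u v 0"
proof (induction u)
  case 0
  show ?case
  proof (induction v)
    case (Suc v)
    then show ?case using rep_Suc_right[of 0 v 0 0] by simp
  qed (rule rep_0)
next
  case (Suc u)
  then show ?case using rep_Suc_left[of u v 0 0] by simp
qed

lemma rep_mono: "rep u v m \<Longrightarrow> u \<le> u' \<Longrightarrow> v \<le> v' \<Longrightarrow> rep u' v' m"
  using rep_add[of u v m "u' - u" "v' - v" 0] rep_zero by simp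

lemma rep_fig5: "0 \<le> x \<Longrightarrow> rep 1 0 (fig 5 x)"
  using rep_Suc_left[OF rep_0] by simp

lemma rep_fig9: "0 \<le> x \<Longrightarrow> rep 0 1 (fig 9 x)"
  using rep_Suc_right[OF rep_0] by simp

lemma rep_imp_sum:
  "rep u v m \<Longrightarrow> \<exists>(n :: nat \<Rightarrow> nat) (l :: nat \<Rightarrow> nat).
     m = (\<Sum>i=1..u. icosahedral (n i)) + (\<Sum>j=1..v. dodecahedral (l j))"
proof (induction rule: rep.induct)
  case (rep_Suc_left u v m x)
  then obtain n l :: "nat \<Rightarrow> nat" where
    "m = (\<Sum>i=1..u. icosahedral (n i)) + (\<Sum>j=1..v. dodecahedral (l j))" by blast
  moreover have "(\<Sum>i=1..u. icosahedral ((n(Suc u := nat x)) i)) = (\<Sum>i=1..u. icosahedral (n i))"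
    by (rule sum.cong) auto
  ultimately have "m + fig 5 x = (\<Sum>i=1..Suc u. icosahedral ((n(Suc u := nat x)) i)) +
      (\<Sum>j=1..v. dodecahedral (l j))"
    using rep_Suc_left.hyps by (simp add: icosahedral_eq_fig)
  then show ?case by blast
next
  case (rep_Suc_right u v m x)
  then obtain n l :: "nat \<Rightarrow> nat" where
    "m = (\<Sum>i=1..u. icosahedral (n i)) + (\<Sum>j=1..v. dodecahedral (l j))" by blast
  moreover have "(\<Sum>i=1..v. dodecahedral ((l(Suc v := nat x)) i)) = (\<Sum>i=1..v. dodecahedral (l i))"
    by (rule sum.cong) auto
  ultimately have "m + fig 9 x = (\<Sum>i=1..u. icosahedral (n i)) +
      (\<Sum>j=1..Suc v. dodecahedral ((l(Suc v := nat x)) j))"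
    using rep_Suc_right.hyps by (simp add: dodecahedral_eq_fig)
  then show ?case by blast
qed simp

lemma admissible_pairI: "(\<And>m. m > 0 \<Longrightarrow> rep u v m) \<Longrightarrow> admissible_pair u v"
  unfolding admissible_pair_def using rep_imp_sum by blast

lemma fig_add_fig:
  "fig c (a + x) + fig c (a - x) = 2 * fig c a + c * (3 * a - 1) * x\<^sup>2"
proof -
  have "2 * fig c (a + x) + 2 * fig c (a - x) = 2 * (2 * fig c a) + 2 * (c * (3 * a - 1) * x\<^sup>2)"
    unfolding two_fig by algebra
  then show ?thesis by linarith
qed

lemma rep_pair5: "\<bar>x\<bar> \<le> a \<Longrightarrow> rep 2 0 (2 * fig 5 a + 5 * (3 * a - 1) * x\<^sup>2)"
  using rep_add[OF rep_fig5[of "a + x"] rep_fig5[of "a - x"]] fig_add_fig[of 5 a x]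
  by (simp add: numeral_2_eq_2 abs_le_iff)

lemma rep_pair9: "\<bar>x\<bar> \<le> a \<Longrightarrow> rep 0 2 (2 * fig 9 a + 9 * (3 * a - 1) * x\<^sup>2)"
  using rep_add[OF rep_fig9[of "a + x"] rep_fig9[of "a - x"]] fig_add_fig[of 9 a x]
  by (simp add: numeral_2_eq_2 abs_le_iff)

lemma abs_le_if_square_le: "x\<^sup>2 \<le> m \<Longrightarrow> m \<le> a\<^sup>2 \<Longrightarrow> 0 \<le> a \<Longrightarrow> \<bar>x\<bar> \<le> a" for x a m :: int
  using abs_le_square_iff[of x a] by simp

lemma rep_80:
  assumes "0 \<le> a" "0 \<le> m" "m \<le> a\<^sup>2"
  shows "rep 8 0 (8 * fig 5 a + 5 * (3 * a - 1) * m)"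
proof -
  obtain x y z w where m: "m = x\<^sup>2 + y\<^sup>2 + z\<^sup>2 + w\<^sup>2" using four_squares[OF assms(2)] sum4_def by auto
  have "\<bar>x\<bar> \<le> a" "\<bar>y\<bar> \<le> a" "\<bar>z\<bar> \<le> a" "\<bar>w\<bar> \<le> a"
    by (rule abs_le_if_square_le[OF _ assms(3,1)], simp add: m)+
  then show ?thesis
    using rep_add[OF rep_add[OF rep_add[OF rep_pair5 rep_pair5] rep_pair5] rep_pair5, of x a y a z a w a]
    by (simp add: m algebra_simps)
qed

lemma rep_08:
  assumes "0 \<le> a" "0 \<le> m" "m \<le> a\<^sup>2"
  shows "rep 0 8 (8 * fig 9 a + 9 * (3 * a - 1) * m)"
proof -
  obtain x y z w where m: "m = x\<^sup>2 + y\<^sup>2 + z\<^sup>2 + w\<^sup>2" using four_squares[OF assms(2)] sum4_def by auto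
  have "\<bar>x\<bar> \<le> a" "\<bar>y\<bar> \<le> a" "\<bar>z\<bar> \<le> a" "\<bar>w\<bar> \<le> a"
    by (rule abs_le_if_square_le[OF _ assms(3,1)], simp add: m)+
  then show ?thesis
    using rep_add[OF rep_add[OF rep_add[OF rep_pair9 rep_pair9] rep_pair9] rep_pair9, of x a y a z a w a]
    by (simp add: m algebra_simps)
qed

lemma rep_44:
  assumes "0 \<le> a" "0 \<le> m" "m \<le> a\<^sup>2" "m mod 3 = 2"
  shows "rep 4 4 (4 * fig 5 a + 4 * fig 9 a + 5 * (3 * a - 1) * m)"
proof -
  obtain x y z w where m: "m = x\<^sup>2 + y\<^sup>2 + 9 * (z\<^sup>2 + w\<^sup>2)"
    using four_squares_two_multiples_of_three[OF assms(2,4)] by blast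
  have "\<bar>x\<bar> \<le> a" "\<bar>y\<bar> \<le> a"
    by (rule abs_le_if_square_le[OF _ assms(3,1)], simp add: m)+
  moreover have "(2*z + w)\<^sup>2 + (z - 2*w)\<^sup>2 = 5 * (z\<^sup>2 + w\<^sup>2)" by algebra
  \<comment> \<open>This keeps the arguments of the two dodecahedral pairs nonnegative: each square
    is at most 5 (z^2 + w^2), which is at most m.\<close>
  then have "(2*z + w)\<^sup>2 \<le> m" "(z - 2*w)\<^sup>2 \<le> m"
    using zero_le_power2[of "2*z + w"] zero_le_power2[of "z - 2*w"] zero_le_power2[of z] zero_le_power2[of w]
      zero_le_power2[of x] zero_le_power2[of y] unfolding m by (smt (verit))+
  then have "\<bar>2*z + w\<bar> \<le> a" "\<bar>z - 2*w\<bar> \<le> a"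
    using abs_le_if_square_le[OF _ assms(3,1)] by blast+
  ultimately have "rep 4 4 ((2 * fig 5 a + 5 * (3 * a - 1) * x\<^sup>2) + (2 * fig 5 a + 5 * (3 * a - 1) * y\<^sup>2)
     + (2 * fig 9 a + 9 * (3 * a - 1) * (2*z + w)\<^sup>2) + (2 * fig 9 a + 9 * (3 * a - 1) * (z - 2*w)\<^sup>2))"
    using rep_add[OF rep_add[OF rep_add[OF rep_pair5 rep_pair5] rep_pair9] rep_pair9, of x a y a "2*z+w" a "z-2*w" a]
    by (simp add: numeral_eq_Suc)
  moreover have "(2 * fig 5 a + 5 * (3 * a - 1) * x\<^sup>2) + (2 * fig 5 a + 5 * (3 * a - 1) * y\<^sup>2)
     + (2 * fig 9 a + 9 * (3 * a - 1) * (2*z + w)\<^sup>2) + (2 * fig 9 a + 9 * (3 * a - 1) * (z - 2*w)\<^sup>2)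
     = 4 * fig 5 a + 4 * fig 9 a + 5 * (3 * a - 1) * m" unfolding m by algebra
  ultimately show ?thesis by (simp only:)
qed

section \<open>Residues of three summands\<close>

lemma two_fig_add:
  "2 * fig c (t + d) = 2 * fig c t + d * (c * (3 * t\<^sup>2 - 2 * t + (3 * t - 1) * d + d\<^sup>2) + 2)"
  unfolding two_fig by algebra

lemma two_fig_cong: "[s = t] (mod M) \<Longrightarrow> [2 * fig c s = 2 * fig c t] (mod M)" for M :: int
  unfolding two_fig by (intro cong_add cong_diff cong_mult cong_pow cong_refl)

text \<open>The halving in \<open>fig\<close> costs one factor 2 of the modulus. Hence an argument
  is later prescribed modulo 2^(k+2) in order to fix a value modulo 2^(k+1).\<close>

lemma fig_cong_double: "[s = t] (mod 2 * M) \<Longrightarrow> [fig c s = fig c t] (mod M)" for M :: int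
proof -
  assume "[s = t] (mod 2 * M)"
  then have "2 * M dvd 2 * (fig c s - fig c t)"
    using two_fig_cong[of s t "2 * M" c] by (simp only: cong_iff_dvd_diff right_diff_distrib)
  then show ?thesis unfolding cong_iff_dvd_diff dvd_mult_cancel_left by simp
qed

text \<open>Hensel lifting: for odd c and t the derivative of the doubled cubic is odd, so adding
  2^(h+1) to t changes \<open>fig c t\<close> by an odd multiple of 2^h and corrects binary digit
  h.\<close>

lemma fig_surj_mod_power_two:
  assumes "odd c"
  shows "\<exists>t. odd t \<and> 0 \<le> t \<and> t < 2 ^ (h + 1) \<and> [fig c t = r] (mod 2 ^ h)"
proof (induction h)
  case 0
  show ?case by (rule exI[of _ 1]) (simp add: cong_def)
next
  case (Suc h)
  then obtain t where t: "odd t" "0 \<le> t" "t < 2 ^ (h + 1)" "[fig c t = r] (mod 2 ^ h)" by blast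
  obtain q where q: "r = fig c t + 2 ^ h * q" using t(4) by (metis cong_iff_lin)
  show ?case
  proof (cases "even q")
    case True
    then obtain q' where "q = 2 * q'" by blast
    then have "[fig c t = r] (mod 2 ^ Suc h)" unfolding q cong_iff_lin
      by (intro exI[of _ q']) simp
    then show ?thesis using t by (intro exI[of _ t]) auto
  next
    case False
    define d :: int where "d = 2 ^ (h + 1)"
    have "even d" by (simp add: d_def)
    define s where "s = c * (3 * t\<^sup>2 - 2 * t + (3 * t - 1) * d + d\<^sup>2) + 2"
    have "odd s" using \<open>odd c\<close> \<open>odd t\<close> \<open>even d\<close> unfolding s_def by simp
    have "2 * fig c (t + d) = 2 * fig c t + d * s" unfolding s_def by (rule two_fig_add)
    then have "fig c (t + d) = fig c t + 2 ^ h * s" by (simp add: d_def)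
    moreover obtain q' where "q - s = 2 * q'" using False \<open>odd s\<close> by (metis odd_even_add dvdE even_diff)
    ultimately have "r = fig c (t + d) + 2 ^ Suc h * q'" using q
      by (simp add: algebra_simps)
    then have "[fig c (t + d) = r] (mod 2 ^ Suc h)" unfolding cong_iff_lin by blast
    then show ?thesis using t \<open>even d\<close> by (intro exI[of _ "t + d"]) (auto simp: d_def)
  qed
qed

text \<open>At even arguments the expansion is integral, and everything beyond the linear term is a
  multiple of 2 e^2, hence of 2^(2k+1) as soon as 2^k divides e.\<close>

lemma fig_even_shift:
  "fig c (2 * z + 2 * e) = fig c (2 * z) + 2 * e * (1 + c * (6 * z\<^sup>2 - 2 * z)) + 2 * e\<^sup>2 * (c * (6 * z - 1) + 2 * c * e)"
proof -
  define X where "X = 2 * e * (1 + c * (6 * z\<^sup>2 - 2 * z)) + 2 * e\<^sup>2 * (c * (6 * z - 1) + 2 * c * e)"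
  have "2 * fig c (2 * z + 2 * e) = 2 * fig c (2 * z) + 2 * X"
    unfolding two_fig X_def by algebra
  then have "fig c (2 * z + 2 * e) = fig c (2 * z) + X" by linarith
  then show ?thesis by (simp add: X_def)
qed

text \<open>Only the linear terms of the expansion survive. Expanding at 0 gives coefficient 1 for
  x, and expanding at 2^g gives 1 plus a multiple of 2^g for y. This discrepancy lets y reach the
  digits above the lowest g.\<close>

lemma fig_top_digits:
  fixes x y :: int
  assumes "g \<ge> 1"
  shows "[fig c (2 ^ (k + 1) * x) + fig c (2 ^ g + 2 ^ (k + 1) * y) =
    fig c (2 ^ g) + 2 ^ (k + 1) * (x + y + 2 ^ g * (c * (3 * 2 ^ (g - 1) - 1)) * y)] (mod 2 ^ (2 * k + 1))"
proof -
  define z :: int where "z = 2 ^ (g - 1)"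
  have z: "2 ^ g = 2 * z" using assms by (simp add: z_def flip: power_Suc)
  define K :: int where "K = 2 ^ k"
  have K: "2 ^ (k + 1) = 2 * K" "2 ^ (2 * k + 1) = 2 * K\<^sup>2" by (simp_all add: K_def power_even_eq)
  have "fig c (2 * K * x) = 2 * (K * x) + 2 * (K * x)\<^sup>2 * (c * (6 * 0 - 1) + 2 * c * (K * x))"
    using fig_even_shift[of c 0 "K * x"] by (simp add: mult.assoc)
  moreover have "fig c (2 * z + 2 * K * y) = fig c (2 * z) + 2 * (K * y) * (1 + c * (6 * z\<^sup>2 - 2 * z))
      + 2 * (K * y)\<^sup>2 * (c * (6 * z - 1) + 2 * c * (K * y))"
    using fig_even_shift[of c z "K * y"] by (simp add: mult.assoc)
  ultimately have "fig c (2 * K * x) + fig c (2 * z + 2 * K * y) =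
      fig c (2 * z) + 2 * K * (x + y + 2 * z * (c * (3 * z - 1)) * y) +
      2 * K\<^sup>2 * (x\<^sup>2 * (c * (6 * 0 - 1) + 2 * c * (K * x)) + y\<^sup>2 * (c * (6 * z - 1) + 2 * c * (K * y)))"
    by algebra
  then show ?thesis unfolding z K z_def[symmetric] cong_iff_dvd_diff by simp
qed

section \<open>Prescribed residues within an interval\<close>

lemma cong_in_interval:
  fixes x lo n :: int
  assumes "n > 0"
  obtains y where "lo \<le> y" "y < lo + n" "[y = x] (mod n)"
proof
  show "lo \<le> lo + (x - lo) mod n" "lo + (x - lo) mod n < lo + n" using assms by simp_all
  show "[lo + (x - lo) mod n = x] (mod n)" by (simp add: cong_def mod_simps)
qed

lemma chinese_remainder_in_interval:
  fixes x y lo m n :: int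
  assumes "coprime m n" "m > 0" "n > 0"
  obtains z where "lo \<le> z" "z < lo + m * n" "[z = x] (mod m)" "[z = y] (mod n)"
proof -
  obtain z where "[z = x] (mod m)" "[z = y] (mod n)"
    using binary_chinese_remainder_int[OF assms(1)] by blast
  moreover obtain z' where "lo \<le> z'" "z' < lo + m * n" "[z' = z] (mod m * n)"
    using cong_in_interval[of "m * n" lo z] assms by auto
  ultimately show thesis
    using that[of z'] cong_modulus_mult[of z' z m n] cong_modulus_mult[of z' z n m]
    by (metis cong_trans mult.commute)
qed

text \<open>Hensel lifting on odd arguments lets \<open>t\<close> fix the residue modulo \<open>2 ^ (k + 1)\<close>. With
  \<open>t1 = 2 ^ (k + 1) * x\<close> and \<open>t2 = 2 ^ g + 2 ^ (k + 1) * y\<close>, the remaining top \<open>k\<close> binary digits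
  depend on \<open>x + y + 2 ^ g * u * y\<close> with \<open>u\<close> odd: the sum \<open>x + y\<close> fixes the lower \<open>g\<close> of them and \<open>y\<close>
  the others. So \<open>t1\<close> and \<open>t2\<close> are only of order \<open>2 ^ (3 * k / 2)\<close>, much smaller than the
  modulus. The odd factor \<open>W\<close> is handled by the Chinese remainder theorem.\<close>

lemma three_figs_residue:
  fixes c c' W V D :: int
  assumes "odd c" "odd c'" "odd W" "W > 0" "odd V" "V > 0" "2 \<le> g" "g \<le> k"
    and small: "\<And>r. \<exists>\<sigma> \<tau>. \<forall>x y. [x + y = \<sigma>] (mod W) \<longrightarrow> [y = \<tau>] (mod V) \<longrightarrow> [fig c x + fig c y = r] (mod W)"
  obtains t0 where "0 \<le> t0" "t0 < 2 ^ (k + 2)"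
    "\<And>t. [t = t0] (mod 2 ^ (k + 2)) \<Longrightarrow> \<exists>t1 t2. 0 \<le> t1 \<and> t1 < 2 ^ (k + 1) * (2 ^ (k - g) * V + 2 ^ g * W) \<and>
        0 \<le> t2 \<and> t2 < 2 ^ g + 2 ^ (k + 1) * (2 ^ (k - g) * V) \<and>
        [fig c t1 + fig c t2 + fig c' t = D] (mod W * 2 ^ (2 * k + 1))"
proof -
  define u where "u = c * (3 * 2 ^ (g - 1) - 1)"
  obtain t0 where t0: "0 \<le> t0" "t0 < 2 ^ (k + 1 + 1)" "[fig c' t0 = D - fig c (2 ^ g)] (mod 2 ^ (k + 1))"
    using fig_surj_mod_power_two[OF \<open>odd c'\<close>, of "k + 1"] by blast
  show thesis
  proof (rule that)
    show "0 \<le> t0" "t0 < 2 ^ (k + 2)" using t0 by simp_all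
    fix t assume t: "[t = t0] (mod 2 ^ (k + 2))"
    have "[fig c' t = D - fig c (2 ^ g)] (mod 2 ^ (k + 1))"
      using fig_cong_double[of t t0 "2 ^ (k + 1)" c'] t t0(3) by (simp add: cong_trans)
    \<comment> \<open>In units of 2^(k+1), w is what the two even arguments must still supply: the
      target is x + y + 2^g * u * y = w modulo 2^k.\<close>
    then obtain w where w: "D - fig c (2 ^ g) = fig c' t + 2 ^ (k + 1) * w" by (metis cong_iff_lin)
    obtain \<sigma> \<tau> where \<sigma>\<tau>: "\<And>x y. [x + y = \<sigma>] (mod W) \<Longrightarrow> [y = \<tau>] (mod V) \<Longrightarrow>
        [fig c x + fig c y = D - fig c' t] (mod W)" using small by blast
    have copW: "coprime (2 ^ n) W" and copV: "coprime (2 ^ n) V" for n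
      using \<open>odd W\<close> \<open>odd V\<close> by simp_all
    obtain s0 where s0: "[2 ^ (k + 1) * s0 = \<sigma> - 2 ^ g] (mod W)"
      using cong_solve_coprime_int[OF copW[of "k + 1"]] by (metis cong_scalar_right mult.assoc mult_1)
    \<comment> \<open>All admissible y lie below \<open>lo\<close>, so choosing the sum s of x and y
      at least \<open>lo\<close> keeps x nonnegative.\<close>
    define lo where "lo = 2 ^ (k - g) * V"
    obtain s where s: "lo \<le> s" "s < lo + 2 ^ g * W" "[s = w] (mod 2 ^ g)" "[s = s0] (mod W)"
      using chinese_remainder_in_interval[OF copW _ \<open>W > 0\<close>, of g lo w s0] by auto
    \<comment> \<open>Since s already agrees with w modulo 2^g, what is left is u * y = q modulo
      2^(k-g), solvable because u is odd.\<close>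
    obtain q where q: "w = s + 2 ^ g * q" using s(3) by (metis cong_iff_lin)
    have "coprime u (2 ^ (k - g))"
      using \<open>odd c\<close> \<open>2 \<le> g\<close> by (simp add: u_def)
    then obtain y0 where y0: "[u * y0 = q] (mod 2 ^ (k - g))"
      using cong_solve_coprime_int by (metis cong_scalar_right mult.assoc mult_1)
    obtain y1 where y1: "[2 ^ (k + 1) * y1 = \<tau> - 2 ^ g] (mod V)"
      using cong_solve_coprime_int[OF copV[of "k + 1"]] by (metis cong_scalar_right mult.assoc mult_1)
    obtain y where y: "0 \<le> y" "y < lo" "[y = y0] (mod 2 ^ (k - g))" "[y = y1] (mod V)"
      using chinese_remainder_in_interval[OF copV _ \<open>V > 0\<close>, of "k - g" 0 y0 y1] unfolding lo_def by auto
    define x where "x = s - y"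
    define t1 t2 where "t1 = 2 ^ (k + 1) * x" and "t2 = 2 ^ g + 2 ^ (k + 1) * y"
    have "0 \<le> x" "x < lo + 2 ^ g * W" using s y unfolding x_def by auto
    then have "0 \<le> t1" "t1 < 2 ^ (k + 1) * (2 ^ (k - g) * V + 2 ^ g * W)"
      unfolding t1_def lo_def by simp_all
    moreover have "0 \<le> t2" "t2 < 2 ^ g + 2 ^ (k + 1) * (2 ^ (k - g) * V)"
      using y unfolding t2_def lo_def by simp_all
    moreover have "[fig c t1 + fig c t2 + fig c' t = D] (mod W * 2 ^ (2 * k + 1))"
    proof (rule coprime_cong_mult)
      have "[u * y = q] (mod 2 ^ (k - g))" using y(3) y0 by (metis cong_scalar_left cong_trans)
      then have "[2 ^ g * (u * y) = 2 ^ g * q] (mod 2 ^ g * 2 ^ (k - g))"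
        by (simp only: cong_iff_dvd_diff flip: right_diff_distrib) simp
      then have "[s + 2 ^ g * (u * y) = w] (mod 2 ^ k)"
        unfolding q using \<open>g \<le> k\<close> by (intro cong_add cong_refl) (simp flip: power_add)
      then have "[2 ^ (k + 1) * (s + 2 ^ g * (u * y)) = 2 ^ (k + 1) * w] (mod 2 ^ (k + 1) * 2 ^ k)"
        by (simp only: cong_iff_dvd_diff flip: right_diff_distrib) simp
      moreover have "2 ^ (k + 1) * 2 ^ k = (2 ^ (2 * k + 1) :: int)" by (simp add: power_even_eq power2_eq_square)
      ultimately have "[2 ^ (k + 1) * (x + y + 2 ^ g * u * y) = 2 ^ (k + 1) * w] (mod 2 ^ (2 * k + 1))"
        by (simp add: x_def mult.assoc)
      then have "[fig c (2 ^ g) + 2 ^ (k + 1) * (x + y + 2 ^ g * u * y) + fig c' t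
          = fig c (2 ^ g) + 2 ^ (k + 1) * w + fig c' t] (mod 2 ^ (2 * k + 1))"
        by (intro cong_add cong_refl)
      moreover have "[fig c t1 + fig c t2 + fig c' t
          = fig c (2 ^ g) + 2 ^ (k + 1) * (x + y + 2 ^ g * u * y) + fig c' t] (mod 2 ^ (2 * k + 1))"
        unfolding t1_def t2_def u_def by (intro cong_add cong_refl fig_top_digits) (use \<open>2 \<le> g\<close> in simp)
      moreover have "fig c (2 ^ g) + 2 ^ (k + 1) * w + fig c' t = D" using w by simp
      ultimately show "[fig c t1 + fig c t2 + fig c' t = D] (mod 2 ^ (2 * k + 1))" by (metis cong_trans)
    next
      have "[2 ^ g + 2 ^ (k + 1) * s = 2 ^ g + (\<sigma> - 2 ^ g)] (mod W)"
        using s(4) s0 by (intro cong_add cong_refl) (metis cong_scalar_left cong_trans)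
      then have "[t1 + t2 = \<sigma>] (mod W)" by (simp add: t1_def t2_def x_def algebra_simps)
      moreover have "[2 ^ g + 2 ^ (k + 1) * y = 2 ^ g + (\<tau> - 2 ^ g)] (mod V)"
        using y(4) y1 by (intro cong_add cong_refl) (metis cong_scalar_left cong_trans)
      then have "[t2 = \<tau>] (mod V)" by (simp add: t2_def)
      ultimately have "[fig c t1 + fig c t2 + fig c' t = D - fig c' t + fig c' t] (mod W)"
        by (intro cong_add cong_refl \<sigma>\<tau>)
      then show "[fig c t1 + fig c t2 + fig c' t = D] (mod W)" by simp
    next
      show "coprime W (2 ^ (2 * k + 1))" by (metis copW coprime_commute)
    qed
    ultimately show "\<exists>t1 t2. 0 \<le> t1 \<and> t1 < 2 ^ (k + 1) * (2 ^ (k - g) * V + 2 ^ g * W) \<and>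
        0 \<le> t2 \<and> t2 < 2 ^ g + 2 ^ (k + 1) * (2 ^ (k - g) * V) \<and>
        [fig c t1 + fig c t2 + fig c' t = D] (mod W * 2 ^ (2 * k + 1))" by blast
  qed
qed

section \<open>Large numbers\<close>

lemma fig_ge: "0 \<le> x \<Longrightarrow> 0 \<le> c \<Longrightarrow> x \<le> fig c x"
proof -
  assume x: "0 \<le> x" "0 \<le> c"
  have "0 \<le> x\<^sup>2 * (x - 1)" using x(1) by (cases "x = 0") auto
  then have "0 \<le> c * (x\<^sup>2 * (x - 1))" using x(2) by simp
  moreover have "2 * fig c x = 2 * x + c * (x\<^sup>2 * (x - 1))" unfolding two_fig by algebra
  ultimately show ?thesis by simp
qed

lemma fig_nonneg: "0 \<le> x \<Longrightarrow> 0 \<le> c \<Longrightarrow> 0 \<le> fig c x"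
  using fig_ge by fastforce

lemma two_fig_le_cube: "0 \<le> x \<Longrightarrow> 2 \<le> c \<Longrightarrow> 2 * fig c x \<le> c * x^3"
proof -
  assume x: "0 \<le> x" "2 \<le> c"
  have "x \<le> x\<^sup>2" using x(1) by (cases "x = 0") (auto simp: power2_eq_square)
  then have "2 * x \<le> c * x\<^sup>2" using x by (intro mult_mono) auto
  then show ?thesis unfolding two_fig by simp
qed

lemma two_fig_step_le:
  assumes "0 \<le> t" "1 \<le> d" "2 \<le> c"
  shows "2 * fig c (t + d) - 2 * fig c t \<le> 3 * c * d * (t + d)\<^sup>2"
proof -
  have "0 \<le> 3 * t * d" "0 \<le> 2 * d\<^sup>2" using assms by simp_all
  then have "1 \<le> 3 * t * d + 2 * d\<^sup>2 + 2 * t + d" using assms by linarith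
  then have "2 * 1 \<le> c * (3 * t * d + 2 * d\<^sup>2 + 2 * t + d)"
    using assms by (intro mult_mono) auto
  then have "c * (3 * t\<^sup>2 - 2 * t + (3 * t - 1) * d + d\<^sup>2) + 2 \<le> 3 * c * (t + d)\<^sup>2"
    by (simp add: algebra_simps power2_eq_square)
  then have "d * (c * (3 * t\<^sup>2 - 2 * t + (3 * t - 1) * d + d\<^sup>2) + 2) \<le> d * (3 * c * (t + d)\<^sup>2)"
    using assms by (intro mult_left_mono) auto
  then show ?thesis unfolding two_fig_add by (simp add: algebra_simps)
qed

text \<open>For odd W, halving is multiplication by h, so \<open>fig c x\<close> is x plus c * h *
  x^2 * (x - 1) modulo W. The linear parts add up to x + y. As W divides c * V, the cubic parts
  depend only on the arguments modulo V. Entry number r of \<open>tab\<close>, counted from 0, is a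
  pair (s, t) that yields residue r.\<close>

lemma fig_pair_residues:
  fixes c W V h :: int
  assumes "odd W" "V dvd W" "W dvd c * V" "[2 * h = 1] (mod W)" "W > 0"
    and table: "map (\<lambda>(s, t). (s + c * h * ((s - t) * (s - t) * (s - t - 1) + t * t * (t - 1))) mod W) tab
      = [0..W - 1]"
  shows "\<exists>s t. \<forall>x y. [x + y = s] (mod W) \<longrightarrow> [y = t] (mod V) \<longrightarrow> [fig c x + fig c y = r] (mod W)"
proof -
  define p where "p x = x * x * (x - 1)" for x :: int
  have fig: "[fig c x = x + h * (c * p x)] (mod W)" for x
  proof -
    have "[2 * fig c x = 2 * x + 1 * (c * p x)] (mod W)"
      unfolding two_fig p_def by (simp add: cong_def algebra_simps power2_eq_square power3_eq_cube)
    moreover have "[2 * x + (2 * h) * (c * p x) = 2 * x + 1 * (c * p x)] (mod W)"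
      by (intro cong_add cong_mult cong_refl assms)
    ultimately have "[2 * fig c x = 2 * (x + h * (c * p x))] (mod W)"
      by (metis cong_sym cong_trans distrib_left mult.assoc)
    then show ?thesis using \<open>odd W\<close> by (metis cong_mult_lcancel coprime_left_2_iff_odd)
  qed
  have p_cong: "[c * p x = c * p y] (mod W)" if "[x = y] (mod V)" for x y
  proof -
    have "[p x = p y] (mod V)" unfolding p_def using that by (intro cong_mult cong_diff cong_refl)
    then have "c * V dvd c * (p x - p y)" by (intro mult_dvd_mono dvd_refl) (simp add: cong_iff_dvd_diff)
    then have "c * V dvd c * p x - c * p y" by (simp only: right_diff_distrib)
    then show ?thesis using assms(3) dvd_trans unfolding cong_iff_dvd_diff by blast
  qed
  obtain s t where st: "(s + c * h * (p (s - t) + p t)) mod W = r mod W"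
  proof -
    have "r mod W \<in> set [0..W - 1]" using \<open>W > 0\<close> by simp
    then show thesis using that unfolding table[symmetric] p_def by auto
  qed
  show ?thesis
  proof (intro exI allI impI)
    fix x y assume xy: "[x + y = s] (mod W)" "[y = t] (mod V)"
    have "[x + y - y = s - t] (mod V)"
      using xy cong_dvd_modulus[OF xy(1) \<open>V dvd W\<close>] by (intro cong_diff)
    then have "[x = s - t] (mod V)" by simp
    then have "[h * (c * p x) + h * (c * p y) = h * (c * p (s - t)) + h * (c * p t)] (mod W)"
      using xy(2) by (intro cong_add cong_mult[OF cong_refl] p_cong)
    then have "[x + y + (h * (c * p x) + h * (c * p y)) = x + y + (h * (c * p (s - t)) + h * (c * p t))] (mod W)"
      by (rule cong_add[OF cong_refl])
    moreover have "(x + h * (c * p x)) + (y + h * (c * p y)) = x + y + (h * (c * p x) + h * (c * p y))"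
      by simp
    ultimately have "[(x + h * (c * p x)) + (y + h * (c * p y)) = x + y + (h * (c * p (s - t)) + h * (c * p t))] (mod W)"
      by (simp only:)
    moreover have "[x + y + (h * (c * p (s - t)) + h * (c * p t)) = s + (h * (c * p (s - t)) + h * (c * p t))] (mod W)"
      by (rule cong_add[OF xy(1) cong_refl])
    moreover have "s + (h * (c * p (s - t)) + h * (c * p t)) = s + c * h * (p (s - t) + p t)"
      by (simp add: algebra_simps)
    moreover have "[s + c * h * (p (s - t) + p t) = r] (mod W)" using st by (simp add: cong_def)
    ultimately show "[fig c x + fig c y = r] (mod W)" using cong_add[OF fig fig] by (metis cong_trans)
  qed
qed

text \<open>A triple \<open>(c, W, V)\<close>: modulo \<open>W\<close> the value \<open>fig c x + fig c y\<close> depends only on \<open>x + y\<close> modulo \<open>W\<close>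
  and on \<open>y\<close> modulo \<open>V\<close>.\<close>

definition residue_params :: "(int \<times> int \<times> int) set" where
  "residue_params = {(5, 15, 3), (9, 15, 5), (5, 9, 9), (9, 9, 1)}"

lemma fig_pair_residues_params:
  assumes "(c, W, V) \<in> residue_params"
  shows "\<exists>s t. \<forall>x y. [x + y = s] (mod W) \<longrightarrow> [y = t] (mod V) \<longrightarrow> [fig c x + fig c y = r] (mod W)"
proof -
  \<comment> \<open>The factors 8 and 5 are the inverses of 2 modulo 15 and modulo 9. Each list
    supplies one witness (s, t) per residue, in increasing order of the residues.\<close>
  have fact1: "map (\<lambda>(s, t). (s + 5 * 8 * ((s - t) * (s - t) * (s - t - 1) + t * t * (t - 1))) mod 15)
      [(0, 0), (1, 0), (2, 1), (3, 0), (4, 0), (5, 1), (6, 0), (7, 0), (8, 1), (9, 0), (10, 0), (11, 1), (2, 0), (13, 0), (14, 1)] = [0..15 - 1 :: int]" by code_simp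
  have fact2: "map (\<lambda>(s, t). (s + 9 * 8 * ((s - t) * (s - t) * (s - t - 1) + t * t * (t - 1))) mod 15)
      [(0, 0), (1, 0), (2, 1), (6, 3), (13, 0), (2, 0), (6, 0), (7, 1), (11, 3), (3, 0), (4, 0), (11, 0), (12, 1), (1, 3), (8, 0)] = [0..15 - 1 :: int]" by code_simp
  have fact3: "map (\<lambda>(s, t). (s + 5 * 5 * ((s - t) * (s - t) * (s - t - 1) + t * t * (t - 1))) mod 9)
      [(0, 0), (1, 0), (2, 1), (2, 0), (7, 0), (8, 1), (6, 0), (4, 0), (5, 1)] = [0..9 - 1 :: int]" by code_simp
  have fact4: "map (\<lambda>(s, t). (s + 9 * 5 * ((s - t) * (s - t) * (s - t - 1) + t * t * (t - 1))) mod 9)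
      [(0, 0), (1, 0), (2, 0), (3, 0), (4, 0), (5, 0), (6, 0), (7, 0), (8, 0)] = [0..9 - 1 :: int]" by code_simp
  consider "c = 5" "W = 15" "V = 3" | "c = 9" "W = 15" "V = 5" | "c = 5" "W = 9" "V = 9" | "c = 9" "W = 9" "V = 1"
    using assms by (auto simp: residue_params_def)
  then show ?thesis
  proof cases
    case 1
    show ?thesis unfolding 1 by (rule fig_pair_residues[OF _ _ _ _ _ fact1]) (simp_all add: cong_def)
  next
    case 2
    show ?thesis unfolding 2 by (rule fig_pair_residues[OF _ _ _ _ _ fact2]) (simp_all add: cong_def)
  next
    case 3
    show ?thesis unfolding 3 by (rule fig_pair_residues[OF _ _ _ _ _ fact3]) (simp_all add: cong_def)
  next
    case 4
    show ?thesis unfolding 4 by (rule fig_pair_residues[OF _ _ _ _ _ fact4]) (simp_all add: cong_def)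
  qed
qed

lemma last_step_below:
  fixes f :: "nat \<Rightarrow> int"
  assumes "f 0 \<le> X" "X < f n"
  obtains j where "f j \<le> X" "X < f (Suc j)"
proof -
  define i where "i = (LEAST i. X < f i)"
  have "X < f i" unfolding i_def using assms(2) by (rule LeastI)
  moreover from this obtain j where j: "i = Suc j" using assms(1) by (cases i) auto
  moreover have "\<not> X < f j" using not_less_Least[of j "\<lambda>i. X < f i"] j unfolding i_def by simp
  ultimately show thesis using that[of j] by simp
qed

text \<open>The third argument \<open>z\<close> is taken as large as possible in its residue class modulo
  \<open>2 ^ (k + 2)\<close>, which is short compared with \<open>a\<close>; this brings the difference into the window
  covered by the eight symmetric terms.\<close>

lemma subtract_three_figs:
  fixes a c c' W V N B off :: int and g e :: nat
  assumes params: "(c, W, V) \<in> residue_params" and c': "c' = 5 \<or> c' = 9"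
    and e: "e = 1 \<or> e = 2" and g: "g \<ge> 5" and k: "k = 2 * g + e" and a: "3 * a = 2 ^ (2 * k + 1) + 1"
    and N: "45 * a^3 \<le> N" "N < 45 * (4 * a)^3" and B: "0 \<le> B" "B \<le> 36 * a^3"
  obtains x y z where "0 \<le> x" "0 \<le> y" "0 \<le> z"
    "0 \<le> N - B - fig c x - fig c y - fig c' z"
    "2 * (N - B - fig c x - fig c y - fig c' z) \<le> 29 * a^3"
    "[N - B - fig c x - fig c y - fig c' z = off] (mod W * 2 ^ (2 * k + 1))"
proof -
  have WV: "odd c" "odd c'" "odd W" "W > 0" "odd V" "V > 0" "2 \<le> c" "2 \<le> c'"
    using params c' by (auto simp: residue_params_def)
  define G :: int where "G = 2 ^ g"
  have "(2::int) ^ 5 \<le> 2 ^ g" using g by (intro power_increasing) auto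
  then have G: "32 \<le> G" by (simp add: G_def)
  have G3: "32 * G^3 \<le> G^4" and G2: "1024 * G\<^sup>2 \<le> G^4" and G1: "G \<le> G^3"
  proof -
    have "32 * G^3 \<le> G * G^3" using G by (intro mult_right_mono) auto
    then show "32 * G^3 \<le> G^4" by (simp add: eval_nat_numeral)
    have "32\<^sup>2 \<le> G\<^sup>2" using G by (intro power_mono) auto
    then have "32\<^sup>2 * G\<^sup>2 \<le> G\<^sup>2 * G\<^sup>2" by (intro mult_right_mono) auto
    then show "1024 * G\<^sup>2 \<le> G^4" by (simp add: eval_nat_numeral mult.assoc)
    show "G \<le> G^3" using power_increasing[of 1 3 G] G by simp
  qed
  have gk: "2 \<le> g" "g \<le> k" using g k by auto
  define L where "L = 2 ^ (k + 1) * (2 ^ (k - g) * V + 2 ^ g * W)"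
  define M where "M = 2 ^ g + 2 ^ (k + 1) * (2 ^ (k - g) * V)"
  define d :: int where "d = 2 ^ (k + 2)"
  have kg: "k - g = g + e" using k by simp
  have pow: "2 ^ (2 * g) = G\<^sup>2" "2 ^ (4 * g) = G^4"
    by (simp_all add: G_def mult.commute flip: power_mult)
  \<comment> \<open>L and M are of order G^3, d is of order G^2 and a of order G^4, so the ratios
    are worst at G = 32 and e = 1. The percentages come from the triples (5, 9, 9) for c = 5 and (9,
    15, 5) for c = 9.\<close>
  have bounds: "100 * L \<le> (if c = 5 then 127 else 118) * a \<and> 100 * M \<le> (if c = 5 then 86 else 49) * a \<and> 300 * d \<le> a"
  proof -
    consider "e = 1" | "e = 2" using e by blast
    then show ?thesis
    proof cases
      case 1
      have "L = 4 * (2 * V + W) * G^3" "M = G + 8 * V * G^3" "d = 8 * G\<^sup>2" "3 * a = 8 * G^4 + 1"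
        using pow a unfolding L_def M_def d_def kg k 1
        by (simp_all add: power_add G_def[symmetric] algebra_simps power2_eq_square power3_eq_cube)
      then show ?thesis using params G3 G2 G1 G unfolding residue_params_def by auto
    next
      case 2
      have "L = 8 * (4 * V + W) * G^3" "M = G + 32 * V * G^3" "d = 16 * G\<^sup>2" "3 * a = 32 * G^4 + 1"
        using pow a unfolding L_def M_def d_def kg k 2
        by (simp_all add: power_add G_def[symmetric] algebra_simps power2_eq_square power3_eq_cube)
      then show ?thesis using params G3 G2 G1 G unfolding residue_params_def by auto
    qed
  qed
  have d1: "1 \<le> d" unfolding d_def by (rule one_le_power) simp
  have a1: "300 \<le> a" using bounds d1 by linarith
  have a3: "0 < a^3" using a1 by simp

  obtain t0 where t0: "0 \<le> t0" "t0 < d"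
    and t0': "\<And>t. [t = t0] (mod d) \<Longrightarrow> \<exists>t1 t2. 0 \<le> t1 \<and> t1 < L \<and> 0 \<le> t2 \<and> t2 < M \<and>
        [fig c t1 + fig c t2 + fig c' t = N - B - off] (mod W * 2 ^ (2 * k + 1))"
    using three_figs_residue[OF WV(1-6) gk fig_pair_residues_params[OF params], of "N - B - off"]
    unfolding L_def M_def d_def by blast

  \<comment> \<open>The reserve 8 a^3 pays for the first two summands, so the difference stays
    nonnegative whenever \<open>fig c' t\<close> is at most X.\<close>
  define X where "X = N - B - 8 * a^3"
  have X: "a^3 \<le> X" "X \<le> 2880 * a^3"
    using N B unfolding X_def by (auto simp: power_mult_distrib)
  have "300 * t0 \<le> a" using t0 bounds by auto
  then have "(300 * t0)^3 \<le> a^3" using t0 by (intro power_mono) auto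
  then have "27000000 * t0^3 \<le> a^3" by (simp add: power_mult_distrib)
  moreover have "0 \<le> t0^3" using t0 by simp
  ultimately have "5 * t0^3 \<le> 2 * a^3" "9 * t0^3 \<le> 2 * a^3" by linarith+
  then have "c' * t0^3 \<le> 2 * a^3" using c' by auto
  then have "fig c' (t0 + d * int 0) \<le> X"
    using two_fig_le_cube[of t0 c'] t0 WV X(1) by simp
  moreover have "X < fig c' (t0 + d * int (nat (X + 1)))"
  proof -
    have X1: "0 \<le> X + 1" "0 \<le> X" using X(1) a3 by linarith+
    have "X < t0 + d * (X + 1)"
      using t0 mult_right_mono[OF d1 X1(1)] by (smt (verit))
    also have "\<dots> \<le> fig c' (t0 + d * (X + 1))"
      using t0 d1 X1 WV by (intro fig_ge add_nonneg_nonneg mult_nonneg_nonneg) auto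
    finally show ?thesis using X1 by simp
  qed
  ultimately obtain j where j: "fig c' (t0 + d * int j) \<le> X" "X < fig c' (t0 + d * int (Suc j))"
    using last_step_below[of "\<lambda>j. fig c' (t0 + d * int j)"] by blast
  define t where "t = t0 + d * int j"
  have t: "0 \<le> t" "fig c' t \<le> X" "X < fig c' (t + d)"
    using j t0 d1 by (simp_all add: t_def algebra_simps)
  \<comment> \<open>An argument above 11 a would have a value of at least (5/2) * 121 * 10 * a^3 =
    3025 a^3, beyond the bound 2880 a^3 on X.\<close>
  have "t \<le> 11 * a"
  proof (rule ccontr)
    assume "\<not> t \<le> 11 * a"
    then have "(11 * a)\<^sup>2 * (10 * a) \<le> t\<^sup>2 * (t - 1)" using a1 by (intro mult_mono power_mono) auto
    moreover have "0 \<le> (11 * a)\<^sup>2 * (10 * a)" using a1 by simp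
    moreover have "5 * y \<le> c' * z" if "y \<le> z" "0 \<le> y" for y z using that c' by auto
    ultimately have "5 * ((11 * a)\<^sup>2 * (10 * a)) \<le> c' * (t\<^sup>2 * (t - 1))" by blast
    moreover have "2 * fig c' t = 2 * t + c' * (t\<^sup>2 * (t - 1))" unfolding two_fig by algebra
    ultimately have "6050 * a^3 \<le> 2 * fig c' t" using t(1) by (simp add: power2_eq_square power3_eq_cube)
    then show False using t(2) X(2) a3 by linarith
  qed
  \<comment> \<open>One step of length d <= a/300 raises the value by at most (13/2) a^3. Together
    with the reserve 8 a^3 this yields the window length (29/2) a^3.\<close>
  have "2 * fig c' (t + d) - 2 * fig c' t \<le> 3 * c' * d * (t + d)\<^sup>2"
    using t d1 WV by (intro two_fig_step_le) auto
  also have "\<dots> \<le> 3 * 9 * d * (12 * a)\<^sup>2"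
    using c' d1 t \<open>t \<le> 11 * a\<close> bounds by (intro mult_mono power_mono) auto
  also have "\<dots> = 3888 * a\<^sup>2 * d" by (simp add: power_mult_distrib)
  finally have "300 * (2 * fig c' (t + d) - 2 * fig c' t) \<le> 3888 * a\<^sup>2 * (300 * d)" by simp
  also have "\<dots> \<le> 3888 * a\<^sup>2 * a" using bounds by (intro mult_left_mono) auto
  finally have step: "300 * (2 * fig c' (t + d) - 2 * fig c' t) \<le> 3888 * a^3"
    by (simp add: power2_eq_square power3_eq_cube)

  obtain x y where xy: "0 \<le> x" "x < L" "0 \<le> y" "y < M"
      "[fig c x + fig c y + fig c' t = N - B - off] (mod W * 2 ^ (2 * k + 1))"
    using t0'[of t] by (auto simp: t_def cong_def)
  have cubes: "(100 * x)^3 \<le> ((if c = 5 then 127 else 118) * a)^3" "(100 * y)^3 \<le> ((if c = 5 then 86 else 49) * a)^3"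
    using xy bounds by (intro power_mono; auto)+
  have "c = 5 \<or> c = 9" using params by (auto simp: residue_params_def)
  \<comment> \<open>Numerically, 5 (1.27^3 + 0.86^3) and 9 (1.18^3 + 0.49^3) are both below 16. The
    fractions in \<open>lin\<close> are these four cubes.\<close>
  then have "c * x^3 + c * y^3 \<le> 16 * a^3"
  proof
    assume c: "c = 5"
    have lin: "5 * X + 5 * Y \<le> 16 * Z" if "1000000 * X \<le> 2048383 * Z" "125000 * Y \<le> 79507 * Z" "0 < Z"
      for X Y Z :: int using that by linarith
    show ?thesis unfolding c by (rule lin[OF _ _ a3]) (use cubes c in \<open>simp_all add: power_mult_distrib\<close>)
  next
    assume c: "c = 9"
    have lin: "9 * X + 9 * Y \<le> 16 * Z" if "125000 * X \<le> 205379 * Z" "1000000 * Y \<le> 117649 * Z" "0 < Z"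
      for X Y Z :: int using that by linarith
    show ?thesis unfolding c by (rule lin[OF _ _ a3]) (use cubes c in \<open>simp_all add: power_mult_distrib\<close>)
  qed
  then have U: "2 * fig c x + 2 * fig c y \<le> 16 * a^3"
    using two_fig_le_cube[of x c] two_fig_le_cube[of y c] xy WV by linarith
  have U': "0 \<le> fig c x" "0 \<le> fig c y" using xy WV by (auto intro: fig_nonneg)
  have "[N - B - (fig c x + fig c y + fig c' t) = N - B - (N - B - off)] (mod W * 2 ^ (2 * k + 1))"
    using xy(5) by (intro cong_diff cong_refl)
  then have "[N - B - fig c x - fig c y - fig c' t = off] (mod W * 2 ^ (2 * k + 1))"
    by (simp add: algebra_simps)
  moreover have "0 \<le> N - B - fig c x - fig c y - fig c' t"
    using U t(2) unfolding X_def by linarith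
  moreover have "2 * (N - B - fig c x - fig c y - fig c' t) \<le> 29 * a^3"
  proof -
    have "2 * fig c' (t + d) - 2 * fig c' t \<le> 13 * a^3"
    proof -
      have "x \<le> 13 * z" if "300 * x \<le> 3888 * z" "0 < z" for x z :: int using that by linarith
      then show ?thesis using step a3 by blast
    qed
    moreover have "N - B - fig c x - fig c y - fig c' t \<le> 8 * a^3 + fig c' (t + d) - fig c' t"
      using U' t(3) unfolding X_def by linarith
    ultimately show ?thesis by simp
  qed
  ultimately show thesis using that xy t(1) by blast
qed


text \<open>In the mixed case the multiplier of \<open>5 * A\<close> must be 2 modulo 3, hence the residue \<open>10 * A\<close>
  modulo \<open>15 * A\<close>.\<close>

lemma bases_represent:
  fixes a d :: int
  assumes a: "10 \<le> a" and A: "A = 3 * a - 1" and d: "0 \<le> d" "2 * d \<le> 29 * a^3"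
  shows "[d = 10 * A] (mod 15 * A) \<Longrightarrow> rep 8 0 (8 * fig 5 a + d)"
    and "[d = 10 * A] (mod 15 * A) \<Longrightarrow> rep 4 4 (4 * fig 5 a + 4 * fig 9 a + d)"
    and "[d = 0] (mod 9 * A) \<Longrightarrow> rep 0 8 (8 * fig 9 a + d)"
proof -
  have A0: "0 < A" using a A by simp
  have "10 * a\<^sup>2 \<le> a * a\<^sup>2" using a by (intro mult_right_mono) auto
  then have a2: "10 * a\<^sup>2 \<le> a^3" by (simp add: power2_eq_square power3_eq_cube)
  \<comment> \<open>The available length 5 A a^2 is almost 15 a^3. The slack above (29/2) a^3
    absorbs the -1 in A = 3 a - 1 once a is at least 10.\<close>
  have m: "0 \<le> m \<and> m \<le> a\<^sup>2" if "d = s * A * m" "5 \<le> s" for m s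
  proof -
    have "0 < s * A" using A0 that by simp
    have "0 \<le> m" using d(1) \<open>0 < s * A\<close> unfolding that(1) by (simp add: zero_le_mult_iff)
    moreover have "5 * A * m \<le> d" unfolding that(1)
      using that(2) A0 \<open>0 \<le> m\<close> by (intro mult_right_mono) auto
    have "m \<le> a\<^sup>2"
    proof (rule ccontr)
      assume "\<not> m \<le> a\<^sup>2"
      then have "5 * A * (a\<^sup>2 + 1) \<le> 5 * A * m" using A0 by (intro mult_left_mono) auto
      then have "2 * (5 * A * (a\<^sup>2 + 1)) \<le> 29 * a^3" using \<open>5 * A * m \<le> d\<close> d(2) by linarith
      then have "30 * a^3 - 10 * a\<^sup>2 + 30 * a - 10 \<le> 29 * a^3"
        unfolding A by (simp add: algebra_simps power2_eq_square power3_eq_cube)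
      then show False using a2 a by linarith
    qed
    ultimately show ?thesis by simp
  qed
  {
    assume "[d = 10 * A] (mod 15 * A)"
    then obtain q where "d = 10 * A + 15 * A * q" by (metis cong_iff_lin cong_sym)
    then have "d = 5 * A * (2 + 3 * q)" by (simp add: algebra_simps)
    moreover have "(2 + 3 * q) mod 3 = 2" by simp
    ultimately obtain n where "d = 5 * A * n" "n mod 3 = 2" by blast
    moreover from this m[of 5 n] have "0 \<le> n" "n \<le> a\<^sup>2" by auto
    ultimately show "rep 8 0 (8 * fig 5 a + d)" "rep 4 4 (4 * fig 5 a + 4 * fig 9 a + d)"
      using rep_80[of a n] rep_44[of a n] a unfolding A by simp_all
  }
  {
    assume "[d = 0] (mod 9 * A)"
    then obtain q where "d = 9 * A * q" by (auto simp: cong_0_iff)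
    moreover from this m[of 9 q] have "0 \<le> q" "q \<le> a\<^sup>2" by auto
    ultimately show "rep 0 8 (8 * fig 9 a + d)" using rep_08[of a q] a unfolding A by simp
  }
qed

text \<open>The centre for which 3 a - 1 is a power of two. The exponent must be odd for
  divisibility by 3.\<close>

definition center :: "nat \<Rightarrow> int" where
  "center k = (2 ^ (2 * k + 1) + 1) div 3"

lemma three_center: "3 * center k = 2 ^ (2 * k + 1) + 1"
proof -
  have "[(2::int) ^ (2 * k + 1) = (- 1) ^ (2 * k + 1)] (mod 3)" by (rule cong_pow) (simp add: cong_def)
  then have "3 dvd (2::int) ^ (2 * k + 1) + 1" by (simp add: cong_iff_dvd_diff)
  then show ?thesis unfolding center_def by simp
qed

text \<open>Since \<open>center (Suc k)\<close> = 4 * \<open>center k\<close> - 1, the ranges from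
  45 a^3 to 45 (4 a)^3 over consecutive centres leave no gap. They start at \<open>center 11\<close>
  = 2796203. The three conclusions differ in the kinds of the eight symmetric summands; i and j
  count the kinds of the three others.\<close>

lemma rep_large:
  assumes N: "45 * 2796203 ^ 3 \<le> N" and ij: "i + j = 3"
  shows "rep (8 + i) j N" "rep (4 + i) (4 + j) N" "rep i (8 + j) N"
proof -
  have ge: "2 * int k \<le> center k" for k
  proof (induction k)
    case (Suc k)
    have "3 * center k = 2 * 2 ^ (2 * k) + 1" "3 * center (Suc k) = 8 * 2 ^ (2 * k) + 1"
      using three_center[of k] three_center[of "Suc k"] by simp_all
    moreover have "(1::int) \<le> 2 ^ (2 * k)" by simp
    ultimately have "center (Suc k) = 4 * center k - 1" "1 \<le> center k" by (smt (verit))+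
    then show ?case using Suc by simp
  qed (simp add: center_def)
  define f where "f n = 45 * center (11 + n) ^ 3" for n
  have "f 0 \<le> N" using N by (simp add: f_def center_def)
  moreover have "N < f (nat N)"
  proof -
    have c1: "1 \<le> center (11 + nat N)" "N < center (11 + nat N)"
      using ge[of "11 + nat N"] by (simp_all split: if_splits)
    note c1(2)
    also have "\<dots> \<le> center (11 + nat N) ^ 3"
      using c1(1) power_increasing[of 1 3 "center (11 + nat N)"] by simp
    also have "\<dots> \<le> f (nat N)" using c1(1) unfolding f_def by simp
    finally show ?thesis .
  qed
  ultimately obtain n where n: "f n \<le> N" "N < f (Suc n)" using last_step_below by blast
  define k where "k = 11 + n"
  define a where "a = center k"
  have a: "3 * a = 2 ^ (2 * k + 1) + 1" unfolding a_def by (rule three_center)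
  have "center (Suc k) \<le> 4 * a" using three_center[of "Suc k"] a by simp
  then have "45 * center (Suc k) ^ 3 \<le> 45 * (4 * a) ^ 3" using ge[of "Suc k"] by (intro mult_left_mono power_mono) auto
  then have Na: "45 * a^3 \<le> N" "N < 45 * (4 * a)^3" using n by (simp_all add: f_def a_def k_def)
  \<comment> \<open>For even k the choice is e = 2 rather than 0, and k >= 11 then guarantees g >=
    5.\<close>
  obtain g e where ge': "k = 2 * g + e" "e = 1 \<or> e = 2" "5 \<le> g"
  proof (cases "odd k")
    case True
    then obtain g where "k = 2 * g + 1" by (elim oddE)
    then show thesis using that[of g 1] by (simp add: k_def)
  next
    case False
    then obtain g where "k = 2 * g" by blast
    then show thesis using that[of "g - 1" 2] by (simp add: k_def)
  qed
  have a10: "10 \<le> a" using ge[of k] unfolding a_def k_def by simp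
  have B: "0 \<le> fig 5 a" "2 * fig 5 a \<le> 5 * a^3" "0 \<le> fig 9 a" "2 * fig 9 a \<le> 9 * a^3" "0 \<le> a^3"
    using a10 by (auto intro: fig_nonneg two_fig_le_cube)
  have red: "rep (p + i) (q + j) N"
    if base: "\<And>d. 0 \<le> d \<Longrightarrow> 2 * d \<le> 29 * a^3 \<Longrightarrow> [d = off] (mod W * 2 ^ (2 * k + 1)) \<Longrightarrow> rep p q (B + d)"
      and W: "W = 9 \<or> W = 15" and "0 \<le> B" "B \<le> 36 * a^3" for p q off W B
  proof -
    have P: "(5, W, if W = 9 then 9 else 3) \<in> residue_params" "(9, W, if W = 9 then 1 else 5) \<in> residue_params"
      using W by (auto simp: residue_params_def)
    have *: "rep (p + i) (q + j) N"
      if cW: "(c, W, V) \<in> residue_params" and c': "c' = 5 \<or> c' = 9"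
        and extra: "\<And>x y z. 0 \<le> x \<Longrightarrow> 0 \<le> y \<Longrightarrow> 0 \<le> z \<Longrightarrow> rep i j (fig c x + fig c y + fig c' z)" for c c' V
    proof -
      obtain x y z where xyz: "0 \<le> x" "0 \<le> y" "0 \<le> z"
        "0 \<le> N - B - fig c x - fig c y - fig c' z"
        "2 * (N - B - fig c x - fig c y - fig c' z) \<le> 29 * a^3"
        "[N - B - fig c x - fig c y - fig c' z = off] (mod W * 2 ^ (2 * k + 1))"
        using subtract_three_figs[OF cW c' ge'(2,3,1) a Na \<open>0 \<le> B\<close> \<open>B \<le> 36 * a^3\<close>] by blast
      show ?thesis using rep_add[OF base[OF xyz(4-6)] extra[OF xyz(1-3)]] by simp
    qed
    \<comment> \<open>Among three summands some kind occurs at least twice. That kind plays the role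
      of c, and the remaining summand that of c'.\<close>
    consider "i = 3" "j = 0" | "i = 2" "j = 1" | "i = 1" "j = 2" | "i = 0" "j = 3" using ij by linarith
    then show ?thesis
    proof cases
      case 1
      show ?thesis by (rule *[OF P(1), of 5])
        (use rep_add[OF rep_add[OF rep_fig5 rep_fig5] rep_fig5] in \<open>simp_all add: 1 numeral_3_eq_3\<close>)
    next
      case 2
      show ?thesis by (rule *[OF P(1), of 9])
        (use rep_add[OF rep_add[OF rep_fig5 rep_fig5] rep_fig9] in \<open>simp_all add: 2 numeral_2_eq_2\<close>)
    next
      case 3
      show ?thesis by (rule *[OF P(2), of 5])
        (use rep_add[OF rep_add[OF rep_fig9 rep_fig9] rep_fig5] in \<open>simp_all add: 3 numeral_2_eq_2\<close>)
    next
      case 4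
      show ?thesis by (rule *[OF P(2), of 9])
        (use rep_add[OF rep_add[OF rep_fig9 rep_fig9] rep_fig9] in \<open>simp_all add: 4 numeral_3_eq_3\<close>)
    qed
  qed
  have A: "2 ^ (2 * k + 1) = 3 * a - 1" using a by simp
  have "rep (8 + i) (0 + j) N"
    by (rule red[of "10 * 2 ^ (2 * k + 1)" 15 8 0 "8 * fig 5 a"]) (use bases_represent(1)[OF a10 A] B in auto)
  then show "rep (8 + i) j N" by simp
  show "rep (4 + i) (4 + j) N"
    by (rule red[of "10 * 2 ^ (2 * k + 1)" 15 4 4 "4 * fig 5 a + 4 * fig 9 a"]) (use bases_represent(2)[OF a10 A] B in auto)
  have "rep (0 + i) (8 + j) N"
    by (rule red[of 0 9 0 8 "8 * fig 9 a"]) (use bases_represent(3)[OF a10 A] B in auto)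
  then show "rep i (8 + j) N" by simp
qed

section \<open>Intervals of represented numbers\<close>

definition cov :: "nat \<Rightarrow> nat \<Rightarrow> int \<Rightarrow> int \<Rightarrow> bool" where
  "cov u v lo hi \<longleftrightarrow> (\<forall>m. lo \<le> m \<longrightarrow> m \<le> hi \<longrightarrow> rep u v m)"

lemma cov_mono: "cov u v lo hi \<Longrightarrow> u \<le> u' \<Longrightarrow> v \<le> v' \<Longrightarrow> lo \<le> lo' \<Longrightarrow> hi' \<le> hi \<Longrightarrow> cov u' v' lo' hi'"
  unfolding cov_def by (meson rep_mono order_trans)

text \<open>A pair \<open>(a, b)\<close> stands for the interval \<open>{a..b}\<close>. Soundness does not depend on the lists being
  sorted; only efficiency does.\<close>

fun merge_ivls :: "(int \<times> int) list \<Rightarrow> (int \<times> int) list \<Rightarrow> (int \<times> int) list" where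
  "merge_ivls [] ys = ys"
| "merge_ivls (x # xs) [] = x # xs"
| "merge_ivls ((a, b) # xs) ((c, d) # ys) =
    (if b + 1 < c then (a, b) # merge_ivls xs ((c, d) # ys)
     else if d + 1 < a then (c, d) # merge_ivls ((a, b) # xs) ys
     else if b \<le> d then merge_ivls xs ((min a c, d) # ys)
     else merge_ivls ((min a c, b) # xs) ys)"

fun shift_ivls :: "int \<Rightarrow> int \<Rightarrow> int \<Rightarrow> (int \<times> int) list \<Rightarrow> (int \<times> int) list" where
  "shift_ivls lo hi t [] = []"
| "shift_ivls lo hi t ((a, b) # xs) =
    (if hi < a + t then []
     else if b + t < lo then shift_ivls lo hi t xs
     else (max (a + t) lo, min (b + t) hi) # shift_ivls lo hi t xs)"

text \<open>A block \<open>(lo, hi, S)\<close> holds the part of a set that lies in \<open>{lo..hi}\<close>; working blockwise keeps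
  the terms short that the simplifier has to rewrite.\<close>

type_synonym blocks = "(int \<times> int \<times> (int \<times> int) list) list"

fun shift_blocks :: "int \<Rightarrow> int \<Rightarrow> int \<Rightarrow> blocks \<Rightarrow> (int \<times> int) list" where
  "shift_blocks lo hi t [] = []"
| "shift_blocks lo hi t ((a, b, S) # Ss) =
    (if hi < a + t then []
     else if b + t < lo then shift_blocks lo hi t Ss
     else shift_ivls lo hi t S @ shift_blocks lo hi t Ss)"

fun add_term :: "int \<Rightarrow> int \<Rightarrow> blocks \<Rightarrow> int list \<Rightarrow> (int \<times> int) list" where
  "add_term lo hi Ss [] = shift_blocks lo hi 0 Ss"
| "add_term lo hi Ss (t # ts) = merge_ivls (shift_blocks lo hi t Ss) (add_term lo hi Ss ts)"

text \<open>A step \<open>(c, n, lo, w, k)\<close> adds at most one summand \<open>fig c i\<close> with \<open>i \<le> n\<close> and keeps the sums in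
  \<open>k\<close> consecutive blocks of width \<open>w\<close> starting at \<open>lo\<close>. The last step stands first.\<close>

fun sum_blocks :: "(int \<times> int \<times> int \<times> int \<times> int) list \<Rightarrow> blocks" where
  "sum_blocks [] = [(0, 0, [(0, 0)])]"
| "sum_blocks ((c, n, lo, w, k) # steps) =
    (let Ss = sum_blocks steps; ts = map (fig c) [1..n]
     in map (\<lambda>i. (lo + w * i, lo + w * i + (w - 1), add_term (lo + w * i) (lo + w * i + (w - 1)) Ss ts)) [0..k - 1])"

text \<open>This and the following auxiliary functions turn the conditions of nested conditionals
  into Boolean arguments. Their equations match on \<open>True\<close> and \<open>False\<close>, so
  symbolic evaluation decides a condition before it enters a branch, and a value such as min a c or
  a + t is passed on instead of being repeated.\<close>

definition merge1 :: "bool \<Rightarrow> int \<Rightarrow> int \<Rightarrow> (int \<times> int) list \<Rightarrow> int \<Rightarrow> int \<Rightarrow> (int \<times> int) list \<Rightarrow> (int \<times> int) list" where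
  "merge1 t a b xs c d ys = (if t then (a, b) # merge_ivls xs ((c, d) # ys)
     else if d + 1 < a then (c, d) # merge_ivls ((a, b) # xs) ys
     else if b \<le> d then merge_ivls xs ((min a c, d) # ys)
     else merge_ivls ((min a c, b) # xs) ys)"

definition merge2 :: "bool \<Rightarrow> int \<Rightarrow> int \<Rightarrow> (int \<times> int) list \<Rightarrow> int \<Rightarrow> int \<Rightarrow> (int \<times> int) list \<Rightarrow> (int \<times> int) list" where
  "merge2 t a b xs c d ys = (if t then (c, d) # merge_ivls ((a, b) # xs) ys
     else if b \<le> d then merge_ivls xs ((min a c, d) # ys)
     else merge_ivls ((min a c, b) # xs) ys)"

definition merge3 :: "bool \<Rightarrow> int \<Rightarrow> int \<Rightarrow> (int \<times> int) list \<Rightarrow> int \<Rightarrow> (int \<times> int) list \<Rightarrow> (int \<times> int) list" where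
  "merge3 t a b xs d ys = (if t then merge_ivls xs ((a, d) # ys) else merge_ivls ((a, b) # xs) ys)"

definition shift1 :: "bool \<Rightarrow> int \<Rightarrow> int \<Rightarrow> int \<Rightarrow> int \<Rightarrow> int \<Rightarrow> (int \<times> int) list \<Rightarrow> (int \<times> int) list" where
  "shift1 q lo hi t a b xs = (if q then [] else if b < lo then shift_ivls lo hi t xs
     else (max a lo, min b hi) # shift_ivls lo hi t xs)"

definition shift2 :: "bool \<Rightarrow> int \<Rightarrow> int \<Rightarrow> int \<Rightarrow> int \<Rightarrow> int \<Rightarrow> (int \<times> int) list \<Rightarrow> (int \<times> int) list" where
  "shift2 q lo hi t a b xs = (if q then shift_ivls lo hi t xs else (max a lo, min b hi) # shift_ivls lo hi t xs)"

definition blocks1 :: "bool \<Rightarrow> int \<Rightarrow> int \<Rightarrow> int \<Rightarrow> int \<Rightarrow> (int \<times> int) list \<Rightarrow> blocks \<Rightarrow> (int \<times> int) list" where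
  "blocks1 q lo hi t b S Ss = (if q then [] else if b < lo then shift_blocks lo hi t Ss
     else shift_ivls lo hi t S @ shift_blocks lo hi t Ss)"

definition blocks2 :: "bool \<Rightarrow> int \<Rightarrow> int \<Rightarrow> int \<Rightarrow> (int \<times> int) list \<Rightarrow> blocks \<Rightarrow> (int \<times> int) list" where
  "blocks2 q lo hi t S Ss = (if q then shift_blocks lo hi t Ss else shift_ivls lo hi t S @ shift_blocks lo hi t Ss)"

lemma merge_ivls_code [code]:
  "merge_ivls [] ys = ys"
  "merge_ivls (x # xs) [] = x # xs"
  "merge_ivls ((a, b) # xs) ((c, d) # ys) = merge1 (b + 1 < c) a b xs c d ys"
  by (simp_all add: merge1_def)

lemma merge1_code [code]:
  "merge1 True a b xs c d ys = (a, b) # merge_ivls xs ((c, d) # ys)"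
  "merge1 False a b xs c d ys = merge2 (d + 1 < a) a b xs c d ys"
  by (simp_all add: merge1_def merge2_def)

lemma merge2_code [code]:
  "merge2 True a b xs c d ys = (c, d) # merge_ivls ((a, b) # xs) ys"
  "merge2 False a b xs c d ys = merge3 (b \<le> d) (min a c) b xs d ys"
  by (simp_all add: merge2_def merge3_def)

lemma merge3_code [code]:
  "merge3 True a b xs d ys = merge_ivls xs ((a, d) # ys)"
  "merge3 False a b xs d ys = merge_ivls ((a, b) # xs) ys"
  by (simp_all add: merge3_def)

lemma shift_ivls_code [code]:
  "shift_ivls lo hi t [] = []"
  "shift_ivls lo hi t ((a, b) # xs) = shift1 (hi < a + t) lo hi t (a + t) (b + t) xs"
  by (simp_all add: shift1_def)

lemma shift1_code [code]:
  "shift1 True lo hi t a b xs = []"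
  "shift1 False lo hi t a b xs = shift2 (b < lo) lo hi t a b xs"
  by (simp_all add: shift1_def shift2_def)

lemma shift2_code [code]:
  "shift2 True lo hi t a b xs = shift_ivls lo hi t xs"
  "shift2 False lo hi t a b xs = (max a lo, min b hi) # shift_ivls lo hi t xs"
  by (simp_all add: shift2_def)

lemma shift_blocks_code [code]:
  "shift_blocks lo hi t [] = []"
  "shift_blocks lo hi t ((a, b, S) # Ss) = blocks1 (hi < a + t) lo hi t (b + t) S Ss"
  by (simp_all add: blocks1_def)

lemma blocks1_code [code]:
  "blocks1 True lo hi t b S Ss = []"
  "blocks1 False lo hi t b S Ss = blocks2 (b < lo) lo hi t S Ss"
  by (simp_all add: blocks1_def blocks2_def)

lemma blocks2_code [code]:
  "blocks2 True lo hi t S Ss = shift_blocks lo hi t Ss"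
  "blocks2 False lo hi t S Ss = shift_ivls lo hi t S @ shift_blocks lo hi t Ss"
  by (simp_all add: blocks2_def)

lemma fig_code [code]: "fig c x = (c * x * x * x - c * x * x + 2 * x) div 2"
  by (simp add: fig_def power2_eq_square power3_eq_cube mult.assoc)

section \<open>Soundness of the interval computations\<close>

lemma merge_ivls_sound:
  assumes "\<forall>(a, b)\<in>set xs. \<forall>m\<in>{a..b}. P m" "\<forall>(a, b)\<in>set ys. \<forall>m\<in>{a..b}. P m"
  shows "\<forall>(a, b)\<in>set (merge_ivls xs ys). \<forall>m\<in>{a..b}. P m"
  using assms
proof (induction xs ys rule: merge_ivls.induct)
  case (3 a b xs c d ys)
  \<comment> \<open>Two integer intervals that overlap or are adjacent have their hull as union,
    which is why the tests compare with b + 1 and d + 1.\<close>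
  have "P m" if "\<not> b + 1 < c" "\<not> d + 1 < a" "min a c \<le> m" "m \<le> max b d" for m
  proof -
    have "m \<in> {a..b} \<or> m \<in> {c..d}" using that by auto
    then show ?thesis using "3.prems" by auto
  qed
  then show ?case using 3 by (auto simp: max_def split: if_splits)
qed auto

lemma shift_ivls_sound:
  assumes "\<forall>(a, b)\<in>set xs. \<forall>m\<in>{a..b}. P (m + t)"
  shows "\<forall>(a, b)\<in>set (shift_ivls lo hi t xs). \<forall>m\<in>{a..b}. P m"
  using assms
proof (induction lo hi t xs rule: shift_ivls.induct)
  case (2 lo hi t a b xs)
  have "P m" if "m \<in> {a + t..b + t}" for m
  proof -
    have "m - t \<in> {a..b}" using that by auto
    then have "P (m - t + t)" using "2.prems" by fastforce
    then show ?thesis by simp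
  qed
  then show ?case using 2 by auto
qed auto

lemma shift_blocks_sound:
  assumes "\<forall>(_, _, S)\<in>set Ss. \<forall>(a, b)\<in>set S. \<forall>m\<in>{a..b}. P (m + t)"
  shows "\<forall>(a, b)\<in>set (shift_blocks lo hi t Ss). \<forall>m\<in>{a..b}. P m"
  using assms
proof (induction lo hi t Ss rule: shift_blocks.induct)
  case (2 lo hi t a b S Ss)
  have "\<forall>(a, b)\<in>set (shift_ivls lo hi t S). \<forall>m\<in>{a..b}. P m"
    using 2(3) by (intro shift_ivls_sound) auto
  then show ?case using 2 by (auto simp: ball_Un)
qed auto

lemma add_term_sound:
  assumes "\<forall>(_, _, S)\<in>set Ss. \<forall>(a, b)\<in>set S. \<forall>m\<in>{a..b}. Q m"
    and "\<And>m. Q m \<Longrightarrow> P m" "\<And>m t. Q m \<Longrightarrow> t \<in> set ts \<Longrightarrow> P (m + t)"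
  shows "\<forall>(a, b)\<in>set (add_term lo hi Ss ts). \<forall>m\<in>{a..b}. P m"
  using assms(3)
proof (induction ts)
  case Nil
  show ?case unfolding add_term.simps by (rule shift_blocks_sound) (use assms(1,2) in fastforce)
next
  case (Cons t ts)
  show ?case unfolding add_term.simps
    by (intro merge_ivls_sound shift_blocks_sound Cons.IH) (use assms(1) Cons.prems in fastforce)+
qed

definition fives :: "(int \<times> 'a) list \<Rightarrow> nat" where
  "fives xs = length (filter (\<lambda>x. fst x = 5) xs)"

definition nines :: "(int \<times> 'a) list \<Rightarrow> nat" where
  "nines xs = length (filter (\<lambda>x. fst x = 9) xs)"

lemma sum_blocks_sound:
  "\<forall>x\<in>set steps. fst x \<in> {5, 9} \<Longrightarrow>
    \<forall>(_, _, S)\<in>set (sum_blocks steps). \<forall>(a, b)\<in>set S. \<forall>m\<in>{a..b}. rep (fives steps) (nines steps) m"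
proof (induction steps)
  case Nil
  then show ?case by (simp add: fives_def nines_def rep_0)
next
  case (Cons x steps)
  obtain c n lo w k where x: "x = (c, n, lo, w, k)" by (cases x)
  let ?u = "fives (x # steps)" and ?v = "nines (x # steps)"
  have "c = 5 \<or> c = 9" using Cons.prems by (simp add: x)
  then have uv: "(c = 5 \<and> ?u = Suc (fives steps) \<and> ?v = nines steps) \<or>
      (c = 9 \<and> ?u = fives steps \<and> ?v = Suc (nines steps))"
    by (auto simp: x fives_def nines_def)
  have "\<forall>(a, b)\<in>set (add_term l h (sum_blocks steps) (map (fig c) [1..n])). \<forall>m\<in>{a..b}. rep ?u ?v m" for l h
  proof (rule add_term_sound)
    show "\<forall>(_, _, S)\<in>set (sum_blocks steps). \<forall>(a, b)\<in>set S. \<forall>m\<in>{a..b}. rep (fives steps) (nines steps) m"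
      using Cons by simp
    fix m assume m: "rep (fives steps) (nines steps) m"
    then show "rep ?u ?v m" using uv by (auto intro: rep_mono)
    fix t assume "t \<in> set (map (fig c) [1..n])"
    then show "rep ?u ?v (m + t)" using uv m by (auto intro!: rep_Suc_left rep_Suc_right)
  qed
  then show ?case by (fastforce simp: x Let_def)
qed

text \<open>Turns a computation into a covered interval: each block of the final step must be
  spanned by a single computed interval, and m lies in the block with index (m - lo) div w.\<close>

lemma cov_sums:
  assumes full: "list_all (\<lambda>(lo, hi, S). list_ex (\<lambda>(a, b). a \<le> lo \<and> hi \<le> b) S) (sum_blocks ((c, n, lo, w, k) # steps))"
    and c: "list_all (\<lambda>x. fst x = 5 \<or> fst x = 9) ((c, n, lo, w, k) # steps)"
    and "fives ((c, n, lo, w, k) # steps) \<le> u" "nines ((c, n, lo, w, k) # steps) \<le> v" "0 < w" "hi = lo + w * k - 1"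
  shows "cov u v lo hi"
  unfolding cov_def
proof (intro allI impI)
  fix m assume m: "lo \<le> m" "m \<le> hi"
  let ?steps = "(c, n, lo, w, k) # steps"
  define i where "i = (m - lo) div w"
  have im: "lo + w * i \<le> m" "m \<le> lo + w * i + (w - 1)"
    using mult_div_mod_eq[of w "m - lo"] pos_mod_bound[of w "m - lo"] pos_mod_sign[of w "m - lo"] \<open>0 < w\<close>
    unfolding i_def by linarith+
  have "i \<in> set [0..k - 1]"
  proof -
    have "0 \<le> i" using m \<open>0 < w\<close> by (simp add: i_def pos_imp_zdiv_nonneg_iff)
    moreover have "w * i < w * k" using im m \<open>hi = _\<close> by linarith
    then have "i < k" using \<open>0 < w\<close> by simp
    ultimately show ?thesis by simp
  qed
  then obtain S where S: "(lo + w * i, lo + w * i + (w - 1), S) \<in> set (sum_blocks ?steps)"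
    by (force simp: Let_def)
  then obtain a b where "(a, b) \<in> set S" "a \<le> lo + w * i" "lo + w * i + (w - 1) \<le> b"
    using full unfolding list_all_iff list_ex_iff by fastforce
  moreover have "\<forall>(a, b)\<in>set S. \<forall>m\<in>{a..b}. rep (fives ?steps) (nines ?steps) m"
    using sum_blocks_sound[of ?steps] c S unfolding list_all_iff by fastforce
  ultimately have "rep (fives ?steps) (nines ?steps) m" using im by fastforce
  then show "rep u v m" by (rule rep_mono) (use assms in auto)
qed

text \<open>The quadratic hypothesis bounds every difference of consecutive values up to
  \<open>fig c x\<close> by hi - lo. Hence the least y that brings m - \<open>fig c y\<close> down
  to hi or below cannot jump past lo.\<close>

lemma fig_gap:
  assumes "hi < m" "m \<le> hi + fig c x" "0 \<le> x" "3 * c * x * x \<le> 2 * (hi - lo)" "2 \<le> c"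
  obtains y where "0 \<le> y" "lo \<le> m - fig c y" "m - fig c y \<le> hi"
proof -
  obtain j where j: "fig c (int j) \<le> m - hi - 1" "m - hi - 1 < fig c (int (Suc j))" "int (Suc j) \<le> x"
  proof -
    define i where "i = (LEAST i. m - hi - 1 < fig c (int i))"
    have w: "m - hi - 1 < fig c (int (nat x))" using assms by simp
    have "m - hi - 1 < fig c (int i)" unfolding i_def using w by (rule LeastI)
    moreover have "i \<le> nat x" unfolding i_def using w by (rule Least_le)
    moreover from calculation(1) obtain j where ij: "i = Suc j" using assms(1) by (cases i) auto
    moreover have "\<not> m - hi - 1 < fig c (int j)"
      using not_less_Least[of j "\<lambda>i. m - hi - 1 < fig c (int i)"] ij unfolding i_def by simp
    ultimately show thesis using that[of j] assms(3) by auto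
  qed
  define y where "y = int (Suc j)"
  have y: "1 \<le> y" "y \<le> x" "fig c (y - 1) \<le> m - hi - 1" "m - hi - 1 < fig c y"
    using j by (simp_all add: y_def)
  have "2 * fig c y - 2 * fig c (y - 1) \<le> 3 * c * y\<^sup>2"
    using two_fig_step_le[of "y - 1" 1 c] y assms by simp
  also have "\<dots> \<le> 3 * c * (x * x)" unfolding power2_eq_square
    using y assms by (intro mult_left_mono mult_mono) auto
  also have "\<dots> \<le> 2 * (hi - lo)" using assms(4) by (simp add: mult.assoc)
  finally show thesis using y by (intro that[of y]) auto
qed

text \<open>If an interval is covered and the gaps between consecutive values \<open>fig c 0, \<dots>, fig c x\<close> do not
  exceed its length, one more summand extends it by \<open>fig c x\<close>.\<close>

fun climb :: "int \<Rightarrow> int \<Rightarrow> (int \<times> int) list \<Rightarrow> int" where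
  "climb lo hi [] = hi"
| "climb lo hi ((c, x) # xs) = climb lo (if 3 * c * x * x \<le> 2 * (hi - lo) then hi + fig c x else hi) xs"

lemma cov_climb:
  "cov u v lo hi \<Longrightarrow> \<forall>(c, x)\<in>set xs. (c = 5 \<or> c = 9) \<and> 0 \<le> x \<Longrightarrow>
    cov (u + fives xs) (v + nines xs) lo (climb lo hi xs)"
proof (induction xs arbitrary: u v hi)
  case Nil
  then show ?case by (simp add: fives_def nines_def)
next
  case (Cons p xs)
  obtain c x where p: "p = (c, x)" by (cases p)
  have c: "c = 5 \<or> c = 9" "0 \<le> x" using Cons.prems p by auto
  define u' v' where "u' = (if c = 5 then Suc u else u)" and "v' = (if c = 9 then Suc v else v)"
  have "cov u' v' lo (if 3 * c * x * x \<le> 2 * (hi - lo) then hi + fig c x else hi)"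
    unfolding cov_def
  proof (intro allI impI)
    fix m assume m: "lo \<le> m" "m \<le> (if 3 * c * x * x \<le> 2 * (hi - lo) then hi + fig c x else hi)"
    show "rep u' v' m"
    proof (cases "m \<le> hi")
      case True
      then have "rep u v m" using Cons.prems(1) m unfolding cov_def by blast
      then show ?thesis by (rule rep_mono) (auto simp: u'_def v'_def)
    next
      case False
      then have le: "m \<le> hi + fig c x" "3 * c * x * x \<le> 2 * (hi - lo)" using m by (auto split: if_splits)
      obtain y where "0 \<le> y" "lo \<le> m - fig c y" "m - fig c y \<le> hi"
        by (rule fig_gap[of hi m c x lo]) (use le False c in auto)
      then have "rep u v (m - fig c y)" using Cons.prems(1) unfolding cov_def by blast
      then show ?thesis
        using rep_Suc_left[of u v "m - fig c y" y] rep_Suc_right[of u v "m - fig c y" y] c \<open>0 \<le> y\<close>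
        by (auto simp: u'_def v'_def)
    qed
  qed
  from Cons.IH[OF this] Cons.prems(2) c show ?case
    by (auto simp: p u'_def v'_def fives_def nines_def)
qed

lemma cov_join: "cov u v a b \<Longrightarrow> cov u v c d \<Longrightarrow> c \<le> b + 1 \<Longrightarrow> cov u v a d"
  unfolding cov_def by (metis linorder_not_less order_trans zless_add1_eq le_less)

lemma cov_climb_to:
  assumes "cov u v lo hi" "list_all (\<lambda>(c, x). (c = 5 \<or> c = 9) \<and> 0 \<le> x) xs"
    and "u + fives xs \<le> u'" "v + nines xs \<le> v'" "m \<le> climb lo hi xs"
  shows "cov u' v' lo m"
  using cov_climb[OF assms(1), of xs] assms(2) cov_mono[OF _ assms(3,4) order_refl assms(5)]
  unfolding list_all_iff by blast

section \<open>Small numbers\<close>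

text \<open>This window serves all pairs from (3, 8) to (9, 2). In it and the next ones, each
  earlier step starts at the start of the step after it minus the largest value added there, cut off
  at 0, because smaller partial sums cannot reach the window.\<close>

lemma cov_3_2_window: "cov 3 2 19899 25299"
  by (rule cov_sums[of 9 8 19899 491 11
      "[(5, 12, 17875, 491, 16), (5, 21, 13903, 491, 24), (5, 21, 0, 1024, 25), (9, 18, 0, 4096, 7)]"]; code_simp)

lemma cov_2_3_window: "cov 2 3 24586 29989"
  by (rule cov_sums[of 9 10 24586 772 7
      "[(5, 14, 20526, 772, 13), (9, 19, 14142, 772, 21), (5, 23, 0, 1024, 30), (9, 19, 0, 4096, 8)]"]; code_simp)

lemma cov_4_1_window: "cov 4 1 25135 28446"
  by (rule cov_sums[of 5 11 25135 552 6
      "[(5, 15, 22099, 552, 12), (9, 18, 14209, 552, 26), (5, 22, 0, 1024, 28), (5, 22, 0, 4096, 7)]"]; code_simp)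

lemma cov_1_5_window: "cov 1 5 10688 16097"
  by (rule cov_sums[of 9 7 10688 541 10
      "[(5, 14, 9358, 541, 13), (9, 6, 2974, 541, 25), (9, 15, 2158, 541, 26), (9, 15, 0, 1024, 16), (9, 15, 0, 4096, 4)]"]; code_simp)

lemma cov_8_0_window: "cov 8 0 1821 2730"
  by (rule cov_sums[of 5 4 1821 455 2
      "[(5, 5, 1697, 455, 3), (5, 6, 1442, 455, 3), (5, 5, 986, 455, 4), (5, 5, 731, 455, 5), (5, 10, 476, 455, 5), (5, 10, 0, 512, 6), (5, 10, 0, 512, 6)]"]; code_simp)

lemma cov_0_12_window: "cov 0 12 404 620"
  by (rule cov_sums[of 9 5 404 217 1 "replicate 11 (9, 5, 0, 621, 1)"]; code_simp)

text \<open>The pattern for all twelve pairs: \<open>low\<close> is computed with every available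
  summand (here 79 needs all 22), \<open>base\<close> with fewer and then climbed to
  \<open>middle\<close>, and a window with still fewer summands is climbed to the threshold of
  \<open>rep_large\<close>. The arguments given to \<open>climb\<close> are about as large as its
  gap test allows.\<close>

lemma cov_0_22: "cov 0 22 0 (45 * 2796203 ^ 3)"
proof -
  have low: "cov 0 22 0 79"
    by (rule cov_sums[of 9 2 0 80 1 "replicate 21 (9, 2, 0, 80, 1)"]; code_simp)
  have base: "cov 0 19 80 192"
    by (rule cov_sums[of 9 3 80 113 1 "replicate 18 (9, 3, 0, 193, 1)"]; code_simp)
  have middle: "cov 0 22 80 403"
    by (rule cov_climb_to[OF base, of "[(9, 2), (9, 3), (9, 4)]"]; code_simp)
  have "cov 0 22 404 (45 * 2796203 ^ 3)"
    by (rule cov_climb_to[OF cov_0_12_window,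
          of "[(9, 4), (9, 5), (9, 8), (9, 14), (9, 32), (9, 107), (9, 645), (9, 9472), (9, 532289), (9, 224213328)]"]; code_simp)
  from cov_join[OF cov_join[OF low middle] this] show ?thesis by simp
qed

lemma cov_1_11: "cov 1 11 0 (45 * 2796203 ^ 3)"
proof -
  have low: "cov 1 11 0 199"
    by (rule cov_sums[of 9 3 0 200 1 "replicate 10 (9, 3, 0, 200, 1) @ [(5, 4, 0, 200, 1)]"]; code_simp)
  have base: "cov 1 8 200 609"
    by (rule cov_sums[of 9 5 200 410 1 "replicate 7 (9, 5, 0, 610, 1) @ [(5, 6, 0, 610, 1)]"]; code_simp)
  have middle: "cov 1 11 200 10687"
    by (rule cov_climb_to[OF base, of "[(9, 5), (9, 8), (9, 14)]"]; code_simp)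
  have "cov 1 11 10688 (45 * 2796203 ^ 3)"
    by (rule cov_climb_to[OF cov_1_5_window,
          of "[(9, 20), (9, 54), (9, 233), (9, 2062), (9, 54085), (9, 7262107)]"]; code_simp)
  from cov_join[OF cov_join[OF low middle] this] show ?thesis by simp
qed

lemma cov_2_9: "cov 2 9 0 (45 * 2796203 ^ 3)"
proof -
  have low: "cov 2 9 0 163"
    by (rule cov_sums[of 9 3 0 164 1 "replicate 8 (9, 3, 0, 164, 1) @ replicate 2 (5, 4, 0, 164, 1)"]; code_simp)
  have base: "cov 2 6 164 650"
    by (rule cov_sums[of 9 5 164 487 1 "replicate 5 (9, 5, 0, 651, 1) @ replicate 2 (5, 6, 0, 651, 1)"]; code_simp)
  have middle: "cov 2 9 164 24585"
    by (rule cov_climb_to[OF base, of "[(9, 6), (9, 9), (9, 17)]"]; code_simp)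
  have "cov 2 9 24586 (45 * 2796203 ^ 3)"
    by (rule cov_climb_to[OF cov_2_3_window,
          of "[(9, 20), (9, 54), (9, 233), (9, 2062), (9, 54085), (9, 7262107)]"]; code_simp)
  from cov_join[OF cov_join[OF low middle] this] show ?thesis by simp
qed

lemma cov_3_8: "cov 3 8 0 (45 * 2796203 ^ 3)"
proof -
  have low: "cov 3 8 0 227"
    by (rule cov_sums[of 9 4 0 228 1 "replicate 7 (9, 4, 0, 228, 1) @ replicate 3 (5, 4, 0, 228, 1)"]; code_simp)
  have base: "cov 3 4 228 494"
    by (rule cov_sums[of 9 5 228 267 1 "replicate 3 (9, 5, 0, 495, 1) @ replicate 3 (5, 6, 0, 495, 1)"]; code_simp)
  have middle: "cov 3 8 228 19898"
    by (rule cov_climb_to[OF base, of "[(9, 4), (9, 6), (9, 9), (9, 17)]"]; code_simp)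
  have "cov 3 8 19899 (45 * 2796203 ^ 3)"
    by (rule cov_climb_to[OF cov_3_2_window,
          of "[(9, 20), (9, 54), (9, 233), (9, 2062), (9, 54085), (9, 7262107)]"]; code_simp)
  from cov_join[OF cov_join[OF low middle] this] show ?thesis by simp
qed

lemma cov_4_7: "cov 4 7 0 (45 * 2796203 ^ 3)"
proof -
  have low: "cov 4 7 0 31"
    by (rule cov_sums[of 9 2 0 32 1 "replicate 6 (9, 2, 0, 32, 1) @ replicate 4 (5, 2, 0, 32, 1)"]; code_simp)
  have base: "cov 4 4 32 518"
    by (rule cov_sums[of 9 5 32 487 1 "replicate 3 (9, 5, 0, 519, 1) @ replicate 4 (5, 6, 0, 519, 1)"]; code_simp)
  have middle: "cov 4 7 32 19898"
    by (rule cov_climb_to[OF base, of "[(9, 6), (9, 9), (9, 17)]"]; code_simp)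
  have "cov 4 7 19899 (45 * 2796203 ^ 3)"
    by (rule cov_climb_to[OF cov_3_2_window,
          of "[(9, 20), (9, 54), (9, 233), (9, 2062), (9, 54085), (5, 9743139)]"]; code_simp)
  from cov_join[OF cov_join[OF low middle] this] show ?thesis by simp
qed

lemma cov_5_6: "cov 5 6 0 (45 * 2796203 ^ 3)"
proof -
  have low: "cov 5 6 0 31"
    by (rule cov_sums[of 9 2 0 32 1 "replicate 5 (9, 2, 0, 32, 1) @ replicate 5 (5, 2, 0, 32, 1)"]; code_simp)
  have base: "cov 4 4 32 400"
    by (rule cov_sums[of 9 4 32 369 1 "replicate 3 (9, 4, 0, 401, 1) @ replicate 4 (5, 5, 0, 401, 1)"]; code_simp)
  have middle: "cov 5 6 32 19898"
    by (rule cov_climb_to[OF base, of "[(5, 7), (9, 9), (9, 17)]"]; code_simp)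
  have "cov 5 6 19899 (45 * 2796203 ^ 3)"
    by (rule cov_climb_to[OF cov_3_2_window,
          of "[(9, 20), (9, 54), (9, 233), (9, 2062), (5, 72563), (5, 11285432)]"]; code_simp)
  from cov_join[OF cov_join[OF low middle] this] show ?thesis by simp
qed

lemma cov_6_5: "cov 6 5 0 (45 * 2796203 ^ 3)"
proof -
  have low: "cov 6 5 0 31"
    by (rule cov_sums[of 9 2 0 32 1 "replicate 4 (9, 2, 0, 32, 1) @ replicate 6 (5, 2, 0, 32, 1)"]; code_simp)
  have base: "cov 4 4 32 370"
    by (rule cov_sums[of 9 4 32 339 1 "replicate 3 (9, 4, 0, 371, 1) @ replicate 4 (5, 5, 0, 371, 1)"]; code_simp)
  have middle: "cov 6 5 32 19898"
    by (rule cov_climb_to[OF base, of "[(9, 5), (5, 10), (5, 20)]"]; code_simp)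
  have "cov 6 5 19899 (45 * 2796203 ^ 3)"
    by (rule cov_climb_to[OF cov_3_2_window,
          of "[(9, 20), (9, 54), (9, 233), (5, 2766), (5, 84018), (5, 14060574)]"]; code_simp)
  from cov_join[OF cov_join[OF low middle] this] show ?thesis by simp
qed

lemma cov_7_4: "cov 7 4 0 (45 * 2796203 ^ 3)"
proof -
  have low: "cov 7 4 0 31"
    by (rule cov_sums[of 9 2 0 32 1 "replicate 3 (9, 2, 0, 32, 1) @ replicate 7 (5, 2, 0, 32, 1)"]; code_simp)
  have base: "cov 4 4 32 326"
    by (rule cov_sums[of 9 4 32 295 1 "replicate 3 (9, 4, 0, 327, 1) @ replicate 4 (5, 5, 0, 327, 1)"]; code_simp)
  have middle: "cov 7 4 32 19898"
    by (rule cov_climb_to[OF base, of "[(5, 6), (5, 10), (5, 20)]"]; code_simp)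
  have "cov 7 4 19899 (45 * 2796203 ^ 3)"
    by (rule cov_climb_to[OF cov_3_2_window,
          of "[(9, 20), (9, 54), (5, 313), (5, 3207), (5, 104887), (5, 19612186)]"]; code_simp)
  from cov_join[OF cov_join[OF low middle] this] show ?thesis by simp
qed

lemma cov_8_3: "cov 8 3 0 (45 * 2796203 ^ 3)"
proof -
  have low: "cov 8 3 0 31"
    by (rule cov_sums[of 9 2 0 32 1 "replicate 2 (9, 2, 0, 32, 1) @ replicate 8 (5, 2, 0, 32, 1)"]; code_simp)
  have base: "cov 5 3 32 326"
    by (rule cov_sums[of 9 4 32 295 1 "replicate 2 (9, 4, 0, 327, 1) @ replicate 5 (5, 5, 0, 327, 1)"]; code_simp)
  have middle: "cov 8 3 32 19898"
    by (rule cov_climb_to[OF base, of "[(5, 6), (5, 10), (5, 20)]"]; code_simp)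
  have "cov 8 3 19899 (45 * 2796203 ^ 3)"
    by (rule cov_climb_to[OF cov_3_2_window,
          of "[(9, 20), (5, 72), (5, 357), (5, 3905), (5, 140923), (5, 30543251)]"]; code_simp)
  from cov_join[OF cov_join[OF low middle] this] show ?thesis by simp
qed

lemma cov_9_2: "cov 9 2 0 (45 * 2796203 ^ 3)"
proof -
  have low: "cov 9 2 0 239"
    by (rule cov_sums[of 9 4 0 240 1 "[(9, 4, 0, 240, 1)] @ replicate 9 (5, 4, 0, 240, 1)"]; code_simp)
  have base: "cov 5 2 240 410"
    by (rule cov_sums[of 9 4 240 171 1 "[(9, 4, 0, 411, 1)] @ replicate 5 (5, 5, 0, 411, 1)"]; code_simp)
  have middle: "cov 9 2 240 19898"
    by (rule cov_climb_to[OF base, of "[(5, 4), (5, 6), (5, 10), (5, 20)]"]; code_simp)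
  have "cov 9 2 19899 (45 * 2796203 ^ 3)"
    by (rule cov_climb_to[OF cov_3_2_window,
          of "[(5, 26), (5, 79), (5, 410), (5, 4804), (5, 192280), (5, 48679129)]"]; code_simp)
  from cov_join[OF cov_join[OF low middle] this] show ?thesis by simp
qed

lemma cov_10_1: "cov 10 1 0 (45 * 2796203 ^ 3)"
proof -
  have low: "cov 10 1 0 362"
    by (rule cov_sums[of 9 4 0 363 1 "replicate 10 (5, 5, 0, 363, 1)"]; code_simp)
  have base: "cov 7 1 363 731"
    by (rule cov_sums[of 9 5 363 369 1 "replicate 7 (5, 6, 0, 732, 1)"]; code_simp)
  have middle: "cov 10 1 363 25134"
    by (rule cov_climb_to[OF base, of "[(5, 7), (5, 12), (5, 26)]"]; code_simp)
  have "cov 10 1 25135 (45 * 2796203 ^ 3)"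
    by (rule cov_climb_to[OF cov_4_1_window,
          of "[(5, 21), (5, 58), (5, 259), (5, 2415), (5, 68548), (5, 10361864)]"]; code_simp)
  from cov_join[OF cov_join[OF low middle] this] show ?thesis by simp
qed

lemma cov_15_0: "cov 15 0 0 (45 * 2796203 ^ 3)"
proof -
  have low: "cov 15 0 0 119"
    by (rule cov_sums[of 5 3 0 120 1 "replicate 14 (5, 3, 0, 120, 1)"]; code_simp)
  have base: "cov 12 0 120 266"
    by (rule cov_sums[of 5 5 120 147 1 "replicate 11 (5, 5, 0, 267, 1)"]; code_simp)
  have middle: "cov 15 0 120 1820"
    by (rule cov_climb_to[OF base, of "[(5, 4), (5, 6), (5, 9)]"]; code_simp)
  have "cov 15 0 1821 (45 * 2796203 ^ 3)"
    by (rule cov_climb_to[OF cov_8_0_window,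
          of "[(5, 11), (5, 22), (5, 62), (5, 286), (5, 2802), (5, 85663), (5, 14475526)]"]; code_simp)
  from cov_join[OF cov_join[OF low middle] this] show ?thesis by simp
qed

section \<open>Essential pairs\<close>

lemma two_fig_lower_bound:
  assumes "int k \<le> x" "0 < k" "0 \<le> c"
  shows "c * (int k)\<^sup>2 * (int k - 1) \<le> 2 * fig c x"
proof -
  have "(int k)\<^sup>2 * (int k - 1) \<le> x\<^sup>2 * (x - 1)"
    using assms by (intro mult_mono power_mono) auto
  then have "c * ((int k)\<^sup>2 * (int k - 1)) \<le> c * (x\<^sup>2 * (x - 1))"
    using assms(3) by (rule mult_left_mono)
  moreover have "2 * fig c x = 2 * x + c * (x\<^sup>2 * (x - 1))" unfolding two_fig by algebra
  ultimately show ?thesis using assms by (simp add: mult.assoc)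
qed

lemma icosahedral_small: "icosahedral n \<le> 95 \<Longrightarrow> icosahedral n \<in> {0, 1, 12, 48}"
proof -
  assume "icosahedral n \<le> 95"
  then have "n < 4" using two_fig_lower_bound[of 4 "int n" 5] by (force simp: icosahedral_eq_fig)
  then have "n = 0 \<or> n = 1 \<or> n = 2 \<or> n = 3" by auto
  then show ?thesis by (auto simp: icosahedral_def)
qed

lemma dodecahedral_small: "dodecahedral n \<le> 79 \<Longrightarrow> dodecahedral n \<in> {0, 1, 20}"
proof -
  assume "dodecahedral n \<le> 79"
  then have "n < 3" using two_fig_lower_bound[of 3 "int n" 9] by (force simp: dodecahedral_eq_fig)
  then have "n = 0 \<or> n = 1 \<or> n = 2" by auto
  then show ?thesis by (auto simp: dodecahedral_def)
qed

lemma sum_counts: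
  fixes f :: "nat \<Rightarrow> int"
  assumes "\<forall>i\<in>{1..a}. f i \<in> {0, 1, y, z}"
  shows "\<exists>p q r. p + q + r \<le> a \<and> (\<Sum>i=1..a. f i) = int p + y * int q + z * int r"
  using assms
proof (induction a)
  case 0
  show ?case by (intro exI[of _ 0]) simp
next
  case (Suc a)
  then obtain p q r where pqr: "p + q + r \<le> a" "(\<Sum>i=1..a. f i) = int p + y * int q + z * int r" by auto
  have "f (Suc a) = 0 \<or> f (Suc a) = 1 \<or> f (Suc a) = y \<or> f (Suc a) = z" using Suc.prems by auto
  then show ?case
  proof (elim disjE)
    assume "f (Suc a) = 0"
    then show ?thesis using pqr by (intro exI[of _ p] exI[of _ q] exI[of _ r]) auto
  next
    assume "f (Suc a) = 1"
    then show ?thesis using pqr by (intro exI[of _ "Suc p"] exI[of _ q] exI[of _ r]) auto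
  next
    assume "f (Suc a) = y"
    then show ?thesis using pqr by (intro exI[of _ p] exI[of _ "Suc q"] exI[of _ r]) (auto simp: algebra_simps)
  next
    assume "f (Suc a) = z"
    then show ?thesis using pqr by (intro exI[of _ p] exI[of _ q] exI[of _ "Suc r"]) (auto simp: algebra_simps)
  qed
qed

text \<open>The bounds stay below the next values: 124 is the next icosahedral number after 48, and
  84 the next dodecahedral number after 20. As 95 exceeds 84, numbers above 79 are treated only for
  v = 0.\<close>

lemma admissible_pair_small:
  assumes "admissible_pair u v" "0 < m" "m \<le> 95" "m \<le> 79 \<or> v = 0"
  obtains p q r s t where "p + q + r \<le> u" "s + t \<le> v" "m = int p + 12 * int q + 48 * int r + int s + 20 * int t"
proof -
  obtain a b n l where ab: "a \<le> u" "b \<le> v"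
    and m: "m = (\<Sum>i=1..a. icosahedral (n i)) + (\<Sum>j=1..b. dodecahedral (l j))"
    using assms(1,2) unfolding admissible_pair_def by blast
  have I0: "0 \<le> icosahedral i" and D0: "0 \<le> dodecahedral i" for i
    by (simp_all add: icosahedral_eq_fig dodecahedral_eq_fig fig_nonneg)
  have "(\<Sum>i=1..a. icosahedral (n i)) \<le> m" "(\<Sum>j=1..b. dodecahedral (l j)) \<le> m"
    unfolding m using I0 D0 by (simp_all add: sum_nonneg)
  then have "icosahedral (n i) \<le> m" if "i \<in> {1..a}" for i
    using member_le_sum[of i "{1..a}" "\<lambda>i. icosahedral (n i)"] that I0 by fastforce
  then have "\<forall>i\<in>{1..a}. icosahedral (n i) \<in> {0, 1, 12, 48}"
    using assms(3) by (meson icosahedral_small order_trans)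
  then obtain p q r where pqr: "p + q + r \<le> a" "(\<Sum>i=1..a. icosahedral (n i)) = int p + 12 * int q + 48 * int r"
    using sum_counts[of a "\<lambda>i. icosahedral (n i)" 12 48] by blast
  have "dodecahedral (l j) \<le> 79" if "j \<in> {1..b}" for j
    using member_le_sum[of j "{1..b}" "\<lambda>i. dodecahedral (l i)"] that D0 assms(4) ab(2)
      \<open>(\<Sum>j=1..b. dodecahedral (l j)) \<le> m\<close> by fastforce
  \<comment> \<open>\<open>sum_counts\<close> expects two values besides 0 and 1; the missing one is
    filled with 0.\<close>
  then have "\<forall>j\<in>{1..b}. dodecahedral (l j) \<in> {0, 1, 20, 0}" using dodecahedral_small by blast
  then obtain s t z where "s + t + z \<le> b" "(\<Sum>j=1..b. dodecahedral (l j)) = int s + 20 * int t + 0 * int z"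
    using sum_counts[of b "\<lambda>j. dodecahedral (l j)" 20 0] by blast
  with pqr ab m show thesis using that[of p q r s t] by simp
qed

text \<open>The shortest sum of ones and twenties for 79 is 3 * 20 + 19, with 22 terms.\<close>

lemma not_admissible_0_21: "\<not> admissible_pair 0 21"
proof
  assume "admissible_pair 0 21"
  then obtain p q r s t where h: "p + q + r \<le> 0" "s + t \<le> 21"
      "79 = int p + 12 * int q + 48 * int r + int s + 20 * int t"
    by (rule admissible_pair_small[of _ _ 79]) auto
  consider "t \<le> 3" | "4 \<le> t" by linarith
  then show False by cases (use h in linarith)+
qed

text \<open>With at most one icosahedral term, 31 is best written as 20 + 11 * 1, with 12 terms; 12
  + 20 already overshoots.\<close>

lemma not_admissible_1_10: "\<not> admissible_pair 1 10"
proof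
  assume "admissible_pair 1 10"
  then obtain p q r s t where h: "p + q + r \<le> 1" "s + t \<le> 10"
      "31 = int p + 12 * int q + 48 * int r + int s + 20 * int t"
    by (rule admissible_pair_small[of _ _ 31]) auto
  have "r = 0" using h by linarith
  consider "t = 0" | "t = 1" "q = 0" | "t = 1" "1 \<le> q" | "2 \<le> t" by linarith
  then show False by cases (use h \<open>r = 0\<close> in linarith)+
qed

text \<open>The shortest icosahedral sum for 95 is 48 + 3 * 12 + 11, with 15 terms.\<close>

lemma not_admissible_14_0: "\<not> admissible_pair 14 0"
proof
  assume "admissible_pair 14 0"
  then obtain p q r s t where h: "p + q + r \<le> 14" "s + t \<le> 0"
      "95 = int p + 12 * int q + 48 * int r + int s + 20 * int t"
    by (rule admissible_pair_small[of _ _ 95]) auto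
  consider "r = 0" "q \<le> 7" | "r = 0" "8 \<le> q" | "r = 1" "q \<le> 3" | "r = 1" "4 \<le> q" | "2 \<le> r" by linarith
  then show False by cases (use h in linarith)+
qed

text \<open>Only the value 1 fits into 11, which therefore needs eleven terms of whichever
  kinds.\<close>

lemma not_admissible_sum_10: "u + v = 10 \<Longrightarrow> \<not> admissible_pair u v"
proof
  assume uv: "u + v = 10"
  assume "admissible_pair u v"
  then obtain p q r s t where h: "p + q + r \<le> u" "s + t \<le> v"
      "11 = int p + 12 * int q + 48 * int r + int s + 20 * int t"
    by (rule admissible_pair_small[of _ _ 11]) auto
  have "q = 0" "r = 0" "t = 0" using h by linarith+
  then show False using h uv by linarith
qed

section \<open>Upward closure and minimal elements\<close>

lemma admissible_pair_mono:
  "admissible_pair u v \<Longrightarrow> u \<le> u' \<Longrightarrow> v \<le> v' \<Longrightarrow> admissible_pair u' v'"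
  unfolding admissible_pair_def by (meson order_trans)

definition minimal_pairs :: "(nat \<times> nat) set" where
  "minimal_pairs = {(5, 6), (4, 7), (3, 8), (2, 9), (1, 11), (0, 22),
     (6, 5), (7, 4), (8, 3), (9, 2), (10, 1), (15, 0)}"

lemma admissible_pair_iff:
  assumes "\<forall>(p, q)\<in>minimal_pairs. admissible_pair p q"
  shows "admissible_pair u v \<longleftrightarrow> (\<exists>(p, q)\<in>minimal_pairs. p \<le> u \<and> q \<le> v)"
proof
  assume uv: "admissible_pair u v"
  show "\<exists>(p, q)\<in>minimal_pairs. p \<le> u \<and> q \<le> v"
  proof (rule ccontr)
    assume "\<not> (\<exists>(p, q)\<in>minimal_pairs. p \<le> u \<and> q \<le> v)"
    then have nd: "\<And>p q. (p, q) \<in> minimal_pairs \<Longrightarrow> \<not> (p \<le> u \<and> q \<le> v)" by blast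
    consider "u = 0" | "u = 1" | "2 \<le> u" "u \<le> 9" | "10 \<le> u" by linarith
    then show False
    proof cases
      case 1
      then have "v \<le> 21" using nd[of 0 22] by (simp add: minimal_pairs_def)
      then show False using admissible_pair_mono[OF uv, of 0 21] not_admissible_0_21 1 by simp
    next
      case 2
      then have "v \<le> 10" using nd[of 1 11] by (simp add: minimal_pairs_def)
      then show False using admissible_pair_mono[OF uv, of 1 10] not_admissible_1_10 2 by simp
    next
      case 3
      then have "u = 2 \<or> u = 3 \<or> u = 4 \<or> u = 5 \<or> u = 6 \<or> u = 7 \<or> u = 8 \<or> u = 9" by linarith
      then have "v \<le> 10 - u"
        using nd[of 2 9] nd[of 3 8] nd[of 4 7] nd[of 5 6] nd[of 6 5] nd[of 7 4] nd[of 8 3] nd[of 9 2]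
        by (elim disjE) (simp_all add: minimal_pairs_def)
      then show False
        using admissible_pair_mono[OF uv, of u "10 - u"] not_admissible_sum_10[of u "10 - u"] 3 by simp
    next
      case 4
      then have "v = 0" "u \<le> 14" using nd[of 10 1] nd[of 15 0] by (simp_all add: minimal_pairs_def)
      then show False using admissible_pair_mono[OF uv, of 14 0] not_admissible_14_0 by simp
    qed
  qed
next
  assume "\<exists>(p, q)\<in>minimal_pairs. p \<le> u \<and> q \<le> v"
  then show "admissible_pair u v" using assms admissible_pair_mono by blast
qed

lemma essential_pairs_eq:
  assumes "\<forall>(p, q)\<in>minimal_pairs. admissible_pair p q"
  shows "essential_pairs = minimal_pairs"
proof (rule set_eqI, clarify)
  fix u v :: nat
  have antichain: "p' = p \<and> q' = q" if "(p, q) \<in> minimal_pairs" "(p', q') \<in> minimal_pairs" "p' \<le> p" "q' \<le> q" for p q p' q'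
    using that unfolding minimal_pairs_def by (elim insertE emptyE) simp_all
  show "(u, v) \<in> essential_pairs \<longleftrightarrow> (u, v) \<in> minimal_pairs"
  proof
    assume "(u, v) \<in> essential_pairs"
    then have uv: "admissible_pair u v"
      and min: "\<And>u' v'. admissible_pair u' v' \<Longrightarrow> u' \<le> u \<Longrightarrow> v' \<le> v \<Longrightarrow> u' = u \<and> v' = v"
      unfolding essential_pairs_def by (auto simp: le_less)
    obtain p q where "(p, q) \<in> minimal_pairs" "p \<le> u" "q \<le> v"
      using uv admissible_pair_iff[OF assms] by blast
    then show "(u, v) \<in> minimal_pairs" using min[of p q] assms by blast
  next
    assume uv: "(u, v) \<in> minimal_pairs"
    have "u' = u \<and> v' = v" if adm: "admissible_pair u' v'" "u' \<le> u" "v' \<le> v" for u' v'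
    proof -
      obtain p q where pq: "(p, q) \<in> minimal_pairs" "p \<le> u'" "q \<le> v'"
        using adm(1) admissible_pair_iff[OF assms] by blast
      then have "p = u \<and> q = v" using antichain[OF uv pq(1)] adm(2,3) by linarith
      then show ?thesis using pq adm by simp
    qed
    then show "(u, v) \<in> essential_pairs" using uv assms unfolding essential_pairs_def by blast
  qed
qed

lemma admissible_pair_if_cov:
  assumes "cov u v 0 (45 * 2796203 ^ 3)" "\<And>m. 45 * 2796203 ^ 3 \<le> m \<Longrightarrow> rep u v m"
  shows "admissible_pair u v"
proof (rule admissible_pairI)
  fix m :: int
  assume "m > 0"
  then show "rep u v m"
    using assms unfolding cov_def by (cases "m \<le> 45 * 2796203 ^ 3") simp_all
qed

lemma admissible_minimal_pairs: "\<forall>(p, q)\<in>minimal_pairs. admissible_pair p q"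
proof -
  \<comment> \<open>The four choices of (i, j) in the three families give every pair with sum 11.
    The larger pairs (1, 11), (0, 22) and (15, 0) follow by monotonicity; their excess is due to
    small numbers only.\<close>
  note large = rep_large[where i = 3 and j = 0] rep_large[where i = 2 and j = 1]
    rep_large[where i = 1 and j = 2] rep_large[where i = 0 and j = 3]
  have "admissible_pair 5 6" by (rule admissible_pair_if_cov[OF cov_5_6]) (use large in simp)
  moreover have "admissible_pair 4 7" by (rule admissible_pair_if_cov[OF cov_4_7]) (use large in simp)
  moreover have "admissible_pair 3 8" by (rule admissible_pair_if_cov[OF cov_3_8]) (use large in simp)
  moreover have "admissible_pair 2 9" by (rule admissible_pair_if_cov[OF cov_2_9]) (use large in simp)
  moreover have "admissible_pair 1 11"
    by (rule admissible_pair_if_cov[OF cov_1_11]) (rule rep_mono[of 1 10], use large in simp_all)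
  moreover have "admissible_pair 0 22"
    by (rule admissible_pair_if_cov[OF cov_0_22]) (rule rep_mono[of 0 11], use large in simp_all)
  moreover have "admissible_pair 6 5" by (rule admissible_pair_if_cov[OF cov_6_5]) (use large in simp)
  moreover have "admissible_pair 7 4" by (rule admissible_pair_if_cov[OF cov_7_4]) (use large in simp)
  moreover have "admissible_pair 8 3" by (rule admissible_pair_if_cov[OF cov_8_3]) (use large in simp)
  moreover have "admissible_pair 9 2" by (rule admissible_pair_if_cov[OF cov_9_2]) (use large in simp)
  moreover have "admissible_pair 10 1" by (rule admissible_pair_if_cov[OF cov_10_1]) (use large in simp)
  moreover have "admissible_pair 15 0"
    by (rule admissible_pair_if_cov[OF cov_15_0]) (rule rep_mono[of 11 0], use large in simp_all)
  ultimately show ?thesis unfolding minimal_pairs_def by simp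
qed

theorem theorem1p5:
  shows "essential_pairs =
    {(5, 6), (4, 7), (3, 8), (2, 9), (1, 11), (0, 22),
     (6, 5), (7, 4), (8, 3), (9, 2), (10, 1), (15, 0)}"
  using essential_pairs_eq[OF admissible_minimal_pairs] unfolding minimal_pairs_def .

end
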